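(* Let $n,t$ be integers with $1\le t\le \frac{n-1}{2}$, and let $F$ be an outerplanar graph that is contained (as a subgraph) in $K_1\vee P_{n-1}$ but is not contained in $K_1\vee\big((t-1)K_2\cup(n-2t+1)K_1\big)$, where $$n\ge \max\left\{1.27\times 10^7,\ \left[(64+|V(F)|)^{1/2}+8\right]^2\right\}.$$ Suppose that $G$ is a connected extremal graph for $\mathrm{spex}_{\mathcal{OP}}(n,F)$, i.e. $G$ is a connected $F$-free outerplanar graph on $n$ vertices with $\rho(G)=\mathrm{spex}_{\mathcal{OP}}(n,F)$, and let $X=(x_v)_{v\in V(G)}$ be the positive eigenvector of $A(G)$ corresponding to $\rho(G)$ with $\max_{v\in V(G)}x_v=1$. Then there exists a vertex $u\in V(G)$ such that $N_G(u)=V(G)\setminus\{u\}$ and $x_u=1$. In particular: (i) $G$ contains a copy of $K_{1,n-1}$; (ii) the subgraph $G[N_G(u)]$ is a disjoint union of some paths.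
   Context: All graphs are finite and simple. $A(G)$ is the adjacency matrix of $G$ and $\rho(G)$ its spectral radius (the maximum modulus of the eigenvalues of $A(G)$). A graph is $F$-free if it does not contain $F$ as a (not necessarily induced) subgraph; "contained in" means isomorphic to a (not necessarily induced) subgraph. $\mathrm{spex}_{\mathcal{OP}}(n,F)$ is the maximum spectral radius over all $n$-vertex $F$-free outerplanar graphs (not required to be connected). $G_1\vee G_2$ is the join of $G_1$ and $G_2$ (disjoint union plus all edges between them), $\cup$ is disjoint union, $mH$ is the disjoint union of $m$ copies of $H$, and $P_k$ is the path on $k$ vertices. $N_G(v)$ is the set of neighbours of $v$, and $G[S]$ is the subgraph induced by $S\subseteq V(G)$. An isolated vertex counts as a path ($P_1$). *)

theory Defs
  imports
    "HOL-Analysis.Path_Connected"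
    "Jordan_Normal_Form.Spectral_Radius"
begin

section \<open>Simple graphs\<close>

record 'a ugraph =
  verts :: "'a set"
  edges :: "'a set set"

definition simple_graph :: "'a ugraph \<Rightarrow> bool" where
  "simple_graph G \<longleftrightarrow> finite (verts G) \<and> (\<forall>e\<in>edges G. e \<subseteq> verts G \<and> card e = 2)"

definition subgraph :: "'a ugraph \<Rightarrow> 'a ugraph \<Rightarrow> bool" where
  "subgraph H G \<longleftrightarrow> simple_graph H \<and> verts H \<subseteq> verts G \<and> edges H \<subseteq> edges G"

definition isomorphic :: "'a ugraph \<Rightarrow> 'b ugraph \<Rightarrow> bool" where
  "isomorphic G H \<longleftrightarrow>
     (\<exists>f. bij_betw f (verts G) (verts H) \<and> edges H = (\<lambda>e. f ` e) ` edges G)"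

definition contained_in :: "'a ugraph \<Rightarrow> 'b ugraph \<Rightarrow> bool" where
  "contained_in F G \<longleftrightarrow> (\<exists>H. subgraph H G \<and> isomorphic F H)"

definition nbrs :: "'a ugraph \<Rightarrow> 'a \<Rightarrow> 'a set" where
  "nbrs G v = {w. {v, w} \<in> edges G}"

definition induced :: "'a ugraph \<Rightarrow> 'a set \<Rightarrow> 'a ugraph" where
  "induced G S = \<lparr>verts = verts G \<inter> S, edges = {e \<in> edges G. e \<subseteq> S}\<rparr>"

definition connected_graph :: "'a ugraph \<Rightarrow> bool" where
  "connected_graph G \<longleftrightarrow> verts G \<noteq> {} \<and>
     (\<forall>u\<in>verts G. \<forall>v\<in>verts G. (u, v) \<in> {(a, b). {a, b} \<in> edges G}\<^sup>*)"

definition complete_graph :: "nat \<Rightarrow> nat ugraph" where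
  "complete_graph k = \<lparr>verts = {..<k}, edges = {{i, j} |i j. i < k \<and> j < k \<and> i \<noteq> j}\<rparr>"

definition path_graph :: "nat \<Rightarrow> nat ugraph" where
  "path_graph k = \<lparr>verts = {..<k}, edges = {{i, Suc i} |i. Suc i < k}\<rparr>"

definition complete_bipartite :: "nat \<Rightarrow> nat \<Rightarrow> (nat + nat) ugraph" where
  "complete_bipartite a b =
     \<lparr>verts = {..<a} <+> {..<b}, edges = {{Inl i, Inr j} |i j. i < a \<and> j < b}\<rparr>"

definition disj_union :: "'a ugraph \<Rightarrow> 'b ugraph \<Rightarrow> ('a + 'b) ugraph" where
  "disj_union G H = \<lparr>verts = verts G <+> verts H,
     edges = (\<lambda>e. Inl ` e) ` edges G \<union> (\<lambda>e. Inr ` e) ` edges H\<rparr>"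

definition join_graph :: "'a ugraph \<Rightarrow> 'b ugraph \<Rightarrow> ('a + 'b) ugraph" where
  "join_graph G H = \<lparr>verts = verts (disj_union G H),
     edges = edges (disj_union G H) \<union> {{Inl u, Inr v} |u v. u \<in> verts G \<and> v \<in> verts H}\<rparr>"

definition disj_Union :: "nat \<Rightarrow> (nat \<Rightarrow> 'a ugraph) \<Rightarrow> (nat \<times> 'a) ugraph" where
  "disj_Union m H = \<lparr>verts = (SIGMA i:{..<m}. verts (H i)),
     edges = (\<Union>i<m. (\<lambda>e. Pair i ` e) ` edges (H i))\<rparr>"

definition copies :: "nat \<Rightarrow> 'a ugraph \<Rightarrow> (nat \<times> 'a) ugraph" where
  "copies m H = disj_Union m (\<lambda>_. H)"

definition union_of_paths :: "'a ugraph \<Rightarrow> bool" where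
  "union_of_paths G \<longleftrightarrow>
     (\<exists>m k. (\<forall>i<m. 1 \<le> k i) \<and> isomorphic G (disj_Union m (\<lambda>i. path_graph (k i))))"

section \<open>Outerplanar graphs\<close>

text \<open>A plane drawing places the vertices at distinct points \<open>p v\<close> and represents every edge
  \<open>e\<close> by an arc \<open>\<gamma> e\<close> joining its end points, such that an arc passes through no vertex other
  than its ends and two arcs meet at most in common end points.\<close>

definition plane_drawing ::
    "'a ugraph \<Rightarrow> ('a \<Rightarrow> complex) \<Rightarrow> ('a set \<Rightarrow> real \<Rightarrow> complex) \<Rightarrow> bool" where
  "plane_drawing G p \<gamma> \<longleftrightarrow>
     inj_on p (verts G) \<and>
     (\<forall>e\<in>edges G. arc (\<gamma> e) \<and> {pathstart (\<gamma> e), pathfinish (\<gamma> e)} = p ` e) \<and>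
     (\<forall>e\<in>edges G. \<forall>v\<in>verts G. p v \<in> path_image (\<gamma> e) \<longrightarrow> v \<in> e) \<and>
     (\<forall>e\<in>edges G. \<forall>f\<in>edges G. e \<noteq> f \<longrightarrow>
        path_image (\<gamma> e) \<inter> path_image (\<gamma> f) \<subseteq> p ` (e \<inter> f))"

definition drawing_points ::
    "'a ugraph \<Rightarrow> ('a \<Rightarrow> complex) \<Rightarrow> ('a set \<Rightarrow> real \<Rightarrow> complex) \<Rightarrow> complex set" where
  "drawing_points G p \<gamma> = p ` verts G \<union> (\<Union>e\<in>edges G. path_image (\<gamma> e))"

text \<open>For a finite graph \<open>drawing_points\<close> is compact, so that \<open>outside\<close> yields the unique
  unbounded face of the drawing.\<close>

definition outerplanar :: "'a ugraph \<Rightarrow> bool" where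
  "outerplanar G \<longleftrightarrow>
     (\<exists>p \<gamma>. plane_drawing G p \<gamma> \<and>
        (\<forall>v\<in>verts G. p v \<in> frontier (outside (drawing_points G p \<gamma>))))"

section \<open>Adjacency matrix and spectral radius\<close>

text \<open>Matrices are indexed by natural numbers, so an arbitrary enumeration of the vertices is
  fixed; another one conjugates the adjacency matrix by a permutation matrix.\<close>

definition vertex_list :: "'a ugraph \<Rightarrow> 'a list" where
  "vertex_list G = (SOME vs. distinct vs \<and> set vs = verts G)"

definition adj_matrix :: "'a ugraph \<Rightarrow> 'b::zero_neq_one mat" where
  "adj_matrix G = Matrix.mat (card (verts G)) (card (verts G))
     (\<lambda>(i, j). if {vertex_list G ! i, vertex_list G ! j} \<in> edges G then 1 else 0)"

definition vertex_vector :: "'a ugraph \<Rightarrow> ('a \<Rightarrow> 'b) \<Rightarrow> 'b vec" where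
  "vertex_vector G x = Matrix.vec (card (verts G)) (\<lambda>i. x (vertex_list G ! i))"

definition graph_spectral_radius :: "'a ugraph \<Rightarrow> real" where
  "graph_spectral_radius G = spectral_radius (adj_matrix G)"

text \<open>Up to isomorphism every graph on \<open>n\<close> vertices has vertex set \<open>{..<n}\<close>, which keeps the
  set of competitors finite.\<close>

definition spex_OP :: "nat \<Rightarrow> 'b ugraph \<Rightarrow> real" where
  "spex_OP n F = Max {graph_spectral_radius H |H :: nat ugraph.
     simple_graph H \<and> verts H = {..<n} \<and> outerplanar H \<and> \<not> contained_in F H}"

end

theory Submission
  imports Defs "HOL-Analysis.Jordan_Curve"
begin

text \<open>Let \<open>r = \<rho>(G)\<close> and \<open>x\<^sub>u = 1\<close>. The star is a competitor, so \<open>r\<^sup>2 \<ge> n - 1\<close>. An outerplanar graph contains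
  no \<open>K\<^sub>2\<^sub>,\<^sub>3\<close> and no subdivided \<open>K\<^sub>4\<close>; hence two vertices have at most two common neighbours, the graph is
  2-degenerate, and every neighbourhood induces a union of paths. Counting walks of length two from \<open>u\<close>
  shows that all but \<open>O(\<surd>n)\<close> vertices are adjacent to \<open>u\<close>. Feeding this back into the eigenvalue
  equation twice gives \<open>r x\<^sub>w < 1\<close> for every vertex \<open>w \<noteq> u\<close> in the set \<open>W\<close> of non-neighbours of \<open>u\<close>.
  If \<open>W\<close> were nonempty, delete all edges at \<open>W\<close> and join \<open>W\<close> to \<open>u\<close>. The result is a fan with some rim
  edges missing, hence outerplanar; it is \<open>F\<close>-free because in a copy of \<open>F\<close> the new leaves could be
  exchanged for unused neighbours of \<open>u\<close>; and by the Rayleigh quotient its spectral radius exceeds \<open>r\<close>.\<close>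

section \<open>Outerplanar drawings and the Jordan curve theorem\<close>

text \<open>Outerplanarity is given by drawings, so both forbidden configurations must come from the
  Jordan curve theorem: every vertex touches the unbounded face, hence no closed curve of the
  drawing encloses one. Fans are the only graphs that ever have to be drawn. The shift of
  \<open>W\<close> to \<open>u\<close> keeps the test vector x. A vertex w of \<open>W\<close> loses
  at most r x_w^2 and gains x_w, so r x_w < 1 is exactly what is needed. One round of estimates
  yields only r x_w <= 51.006, which is why a second one follows. The two conditions on n have
  separate duties. The numerical one makes r large enough for the second round. The other says
  |V(F)| <= n - 16 sqrt n; as \<open>u\<close> has at least n - 1 - 12 sqrt n neighbours, a copy of
  \<open>F\<close> always leaves enough of them for the exchange. The graph that \<open>F\<close> is
  assumed to avoid has a spanning star, which makes the star a competitor.\<close>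

definition arc_between :: "complex set \<Rightarrow> complex \<Rightarrow> complex \<Rightarrow> bool" where
  "arc_between S a b \<longleftrightarrow> (\<exists>g. arc g \<and> path_image g = S \<and> pathstart g = a \<and> pathfinish g = b)"

lemma arc_between_sym: "arc_between S a b \<Longrightarrow> arc_between S b a"
  unfolding arc_between_def
  by (metis arc_reversepath path_image_reversepath pathfinish_reversepath pathstart_reversepath)

lemma arc_between_join:
  assumes "arc_between S a b" "arc_between T b c" "S \<inter> T \<subseteq> {b}"
  shows "arc_between (S \<union> T) a c"
proof -
  obtain g h where "arc g" "path_image g = S" "pathstart g = a" "pathfinish g = b"
    "arc h" "path_image h = T" "pathstart h = b" "pathfinish h = c"
    using assms by (auto simp: arc_between_def)
  with assms(3) show ?thesis
    unfolding arc_between_def by (intro exI[of _ "g +++ h"]) (auto simp: arc_join path_image_join)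
qed

lemma arc_between_facts:
  assumes "arc_between S a b"
  shows "a \<in> S" "b \<in> S" "a \<noteq> b" "compact S" "connected S" "connected (S - {a, b})"
    "S \<subseteq> closure (S - {a, b})" "S - {a, b} \<noteq> {}"
proof -
  obtain g where g: "arc g" "path_image g = S" "pathstart g = a" "pathfinish g = b"
    using assms by (auto simp: arc_between_def)
  have sp: "simple_path g" using g by (simp add: arc_imp_simple_path)
  show "a \<in> S" "b \<in> S" using g by auto
  show ab: "a \<noteq> b" using g arc_distinct_ends by blast
  show "compact S" "connected S" using g by (auto simp: compact_arc_image connected_arc_image)
  show con: "connected (S - {a, b})" using connected_simple_path_endless[OF sp] g by auto
  show ne: "S - {a, b} \<noteq> {}" using simple_path_endless[OF sp] g by auto
  have "connected S" "closed S" using g by (auto simp: connected_arc_image closed_arc_image)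
  \<comment> \<open>A connected set with more than one point has no isolated points, and removing
    two points does not change which points are limit points.\<close>
  show "S \<subseteq> closure (S - {a, b})"
  proof (rule ccontr)
    assume "\<not> ?thesis"
    then obtain x where x: "x \<in> S" "x \<notin> closure (S - {a, b})" by blast
    then have xab: "x \<in> {a, b}" using closure_subset[of "S - {a, b}"] by auto
    have "\<not> x islimpt (S - {a, b})" using x(2) by (auto simp: closure_def)
    then have "\<not> x islimpt insert a (insert b (S - {a, b}))" by (simp add: islimpt_insert)
    moreover have "insert a (insert b (S - {a, b})) = S" using \<open>a \<in> S\<close> \<open>b \<in> S\<close> by blast
    ultimately have "\<not> x islimpt S" by simp
    moreover have "x islimpt S"
      by (rule connected_imp_perfect[OF \<open>connected S\<close>]) (use x ab \<open>a \<in> S\<close> \<open>b \<in> S\<close> in auto)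
    ultimately show False by blast
  qed
qed

lemma jordan_two_arcs:
  assumes "arc_between S a b" "arc_between T a b" "S \<inter> T = {a, b}"
  shows "open (inside (S \<union> T))" "open (outside (S \<union> T))" "connected (inside (S \<union> T))"
    "connected (outside (S \<union> T))" "inside (S \<union> T) \<noteq> {}"
    "frontier (inside (S \<union> T)) = S \<union> T"
proof -
  obtain g h where gh: "arc g" "path_image g = S" "pathstart g = a" "pathfinish g = b"
    "arc h" "path_image h = T" "pathstart h = a" "pathfinish h = b"
    using assms by (auto simp: arc_between_def)
  have "simple_path (g +++ reversepath h)"
    by (rule simple_path_join_loop) (use gh assms(3) in \<open>auto simp: arc_reversepath\<close>)
  moreover have "path_image (g +++ reversepath h) = S \<union> T"
    using gh by (simp add: path_image_join)
  moreover have "pathfinish (g +++ reversepath h) = pathstart (g +++ reversepath h)" using gh by simp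
  ultimately show "open (inside (S \<union> T))" "open (outside (S \<union> T))" "connected (inside (S \<union> T))"
    "connected (outside (S \<union> T))" "inside (S \<union> T) \<noteq> {}" "frontier (inside (S \<union> T)) = S \<union> T"
    using Jordan_inside_outside[of "g +++ reversepath h"] by simp_all
qed

section \<open>Theta curves and K4 drawings against the outer face\<close>

lemma connected_avoiding_side:
  fixes A C :: "complex set"
  assumes "closed C" "connected A" "A \<inter> C = {}"
  shows "A \<subseteq> inside C \<or> A \<subseteq> outside C"
proof -
  have "A \<subseteq> inside C \<union> outside C" using assms(3) inside_Un_outside[of C] by blast
  then show ?thesis
    using connectedD[OF assms(2) open_inside[OF assms(1)] open_outside[OF assms(1)]]
      inside_Int_outside[of C] by blast
qed

lemma arc_side:
  assumes "arc_between S a b" "closed C" "S \<inter> C \<subseteq> {a, b}"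
  shows "S - {a, b} \<subseteq> inside C \<or> S - {a, b} \<subseteq> outside C"
  by (rule connected_avoiding_side[OF assms(2) arc_between_facts(6)[OF assms(1)]]) (use assms(3) in auto)

text \<open>If the two insides met, each, being connected and disjoint from the other cycle, would
  lie in the other. Equal insides have equal frontiers, which would put all of \<open>S1\<close> on
  \<open>S2\<close> and \<open>S3\<close>.\<close>

lemma theta_inside_disjoint:
  assumes a1: "arc_between S1 a b" and a2: "arc_between S2 a b" and a3: "arc_between S3 a b"
    and i: "S1 \<inter> S2 = {a, b}" "S1 \<inter> S3 = {a, b}" "S2 \<inter> S3 = {a, b}"
    and o3: "S3 - {a, b} \<subseteq> outside (S1 \<union> S2)" and o1: "S1 - {a, b} \<subseteq> outside (S2 \<union> S3)"
  shows "inside (S1 \<union> S2) \<inter> inside (S2 \<union> S3) = {}"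
proof (rule ccontr)
  assume ne: "\<not> ?thesis"
  note j12 = jordan_two_arcs[OF a1 a2 i(1)] and j23 = jordan_two_arcs[OF a2 a3 i(3)]
  have cl: "closed (S1 \<union> S2)" "closed (S2 \<union> S3)"
    using arc_between_facts(4)[OF a1] arc_between_facts(4)[OF a2] arc_between_facts(4)[OF a3]
    by (auto simp: compact_imp_closed)
  have ab: "a \<in> S2" "b \<in> S2" using arc_between_facts[OF a2] by auto
  have d12: "inside (S1 \<union> S2) \<inter> (S2 \<union> S3) = {}"
    using o3 inside_Int_outside[of "S1 \<union> S2"] inside_no_overlap[of "S1 \<union> S2"] ab by blast
  have d23: "inside (S2 \<union> S3) \<inter> (S1 \<union> S2) = {}"
    using o1 inside_Int_outside[of "S2 \<union> S3"] inside_no_overlap[of "S2 \<union> S3"] ab by blast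
  have "inside (S1 \<union> S2) \<subseteq> inside (S2 \<union> S3)"
    using connected_avoiding_side[OF cl(2) j12(3) d12] ne inside_Int_outside[of "S2 \<union> S3"] by blast
  moreover have "inside (S2 \<union> S3) \<subseteq> inside (S1 \<union> S2)"
    using connected_avoiding_side[OF cl(1) j23(3) d23] ne inside_Int_outside[of "S1 \<union> S2"] by blast
  ultimately have "inside (S1 \<union> S2) = inside (S2 \<union> S3)" by (rule subset_antisym)
  then have "frontier (inside (S1 \<union> S2)) = frontier (inside (S2 \<union> S3))" by (rule arg_cong)
  then have "S1 \<union> S2 = S2 \<union> S3" unfolding j12(6) j23(6) .
  then show False using i arc_between_facts(8)[OF a1] by blast
qed

text \<open>Otherwise a point inside \<open>S2 \<union> S3\<close> is outside both cycles through
  \<open>S1\<close>, so neither of these separates it from infinity. They meet in the connected set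
  \<open>S1\<close>, so by Janiszewski's theorem their union does not separate it either, although
  that union contains \<open>S2 \<union> S3\<close>.\<close>

lemma theta_arc_inside:
  assumes a1: "arc_between S1 a b" and a2: "arc_between S2 a b" and a3: "arc_between S3 a b"
    and i: "S1 \<inter> S2 = {a, b}" "S1 \<inter> S3 = {a, b}" "S2 \<inter> S3 = {a, b}"
  shows "S1 - {a, b} \<subseteq> inside (S2 \<union> S3) \<or> S2 - {a, b} \<subseteq> inside (S1 \<union> S3) \<or>
    S3 - {a, b} \<subseteq> inside (S1 \<union> S2)"
proof (rule ccontr)
  assume n: "\<not> ?thesis"
  note co = arc_between_facts(4)[OF a1] arc_between_facts(4)[OF a2] arc_between_facts(4)[OF a3]
  have cl: "closed (S1 \<union> S2)" "closed (S1 \<union> S3)" "closed (S2 \<union> S3)"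
    using co by (auto simp: compact_imp_closed)
  have o: "S1 - {a, b} \<subseteq> outside (S2 \<union> S3)" "S2 - {a, b} \<subseteq> outside (S1 \<union> S3)"
    "S3 - {a, b} \<subseteq> outside (S1 \<union> S2)"
  proof -
    have "S1 \<inter> (S2 \<union> S3) \<subseteq> {a, b}" "S2 \<inter> (S1 \<union> S3) \<subseteq> {a, b}" "S3 \<inter> (S1 \<union> S2) \<subseteq> {a, b}"
      using i by auto
    from arc_side[OF a1 cl(3) this(1)] arc_side[OF a2 cl(2) this(2)] arc_side[OF a3 cl(1) this(3)] n
    show "S1 - {a, b} \<subseteq> outside (S2 \<union> S3)" "S2 - {a, b} \<subseteq> outside (S1 \<union> S3)"
      "S3 - {a, b} \<subseteq> outside (S1 \<union> S2)" by simp_all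
  qed
  obtain x where x: "x \<in> inside (S2 \<union> S3)" using jordan_two_arcs(5)[OF a2 a3 i(3)] by blast
  have "inside (S1 \<union> S2) \<inter> inside (S2 \<union> S3) = {}"
    by (rule theta_inside_disjoint[OF a1 a2 a3 i o(3) o(1)])
  moreover have "inside (S1 \<union> S3) \<inter> inside (S3 \<union> S2) = {}"
    using theta_inside_disjoint[OF a1 a3 a2 i(2) i(1)] i(3) o by (simp add: Un_commute Int_commute)
  ultimately have "x \<notin> inside (S1 \<union> S2)" "x \<notin> inside (S1 \<union> S3)" using x by (auto simp: Un_commute)
  moreover have "x \<notin> S1"
    using x o(1) inside_Int_outside[of "S2 \<union> S3"] inside_no_overlap[of "S2 \<union> S3"]
      arc_between_facts(1,2)[OF a2] by blast
  moreover have "x \<notin> S2 \<union> S3" using x inside_no_overlap[of "S2 \<union> S3"] by blast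
  ultimately have xo: "x \<in> outside (S1 \<union> S2)" "x \<in> outside (S1 \<union> S3)"
    unfolding outside_inside by simp_all
  have "bounded (S1 \<union> S2 \<union> (S1 \<union> S3))" using co by (simp add: compact_imp_bounded)
  then have "outside (S1 \<union> S2 \<union> (S1 \<union> S3)) \<noteq> {}" by (rule outside_bounded_nonempty)
  then obtain w where w: "w \<in> outside (S1 \<union> S2 \<union> (S1 \<union> S3))" by blast
  then have wo: "w \<in> outside (S1 \<union> S2)" "w \<in> outside (S1 \<union> S3)"
    using outside_mono[of "S1 \<union> S2" "S1 \<union> S2 \<union> (S1 \<union> S3)"]
      outside_mono[of "S1 \<union> S3" "S1 \<union> S2 \<union> (S1 \<union> S3)"] by auto
  have "connected_component (- (S1 \<union> S2 \<union> (S1 \<union> S3))) w x"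
  proof (rule Janiszewski)
    show "compact (S1 \<union> S2)" "closed (S1 \<union> S3)" using co cl by auto
    have "(S1 \<union> S2) \<inter> (S1 \<union> S3) = S1" using i arc_between_facts(1,2)[OF a1] by blast
    then show "connected ((S1 \<union> S2) \<inter> (S1 \<union> S3))" using arc_between_facts(5)[OF a1] by simp
    show "connected_component (- (S1 \<union> S2)) w x"
      unfolding connected_component_def using xo wo
      by (intro exI[of _ "outside (S1 \<union> S2)"] conjI jordan_two_arcs(4)[OF a1 a2 i(1)]) (auto simp: outside_def)
    show "connected_component (- (S1 \<union> S3)) w x"
      unfolding connected_component_def using xo wo
      by (intro exI[of _ "outside (S1 \<union> S3)"] conjI jordan_two_arcs(4)[OF a1 a3 i(2)]) (auto simp: outside_def)
  qed
  then have "x \<in> outside (S1 \<union> S2 \<union> (S1 \<union> S3))"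
    using w outside_same_component by blast
  then have "x \<in> outside (S2 \<union> S3)"
    using outside_mono[of "S2 \<union> S3" "S1 \<union> S2 \<union> (S1 \<union> S3)"] by auto
  then show False using x inside_Int_outside[of "S2 \<union> S3"] by blast
qed

text \<open>With \<open>K\<close> the whole drawing, this is how the outer face is used: a vertex on
  its boundary is not enclosed by any closed curve contained in the drawing.\<close>

lemma inside_not_in_closure_outside:
  fixes C K :: "complex set"
  assumes "x \<in> inside C" "closed C" "C \<subseteq> K"
  shows "x \<notin> closure (outside K)"
  using assms open_inside[OF assms(2)] outside_mono[OF assms(3)] inside_Int_outside[of C]
  by (metis IntI closure_iff_nhds_not_empty disjoint_iff subsetD subset_refl)

text \<open>Some arc lies inside the cycle formed by the other two. The exposed points
  \<open>m2\<close> and \<open>m3\<close> rule out \<open>S2\<close> and \<open>S3\<close>, which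
  leaves \<open>S1\<close>.\<close>

lemma theta_middle_hidden:
  assumes a1: "arc_between S1 a b" and a2: "arc_between S2 a b" and a3: "arc_between S3 a b"
    and i: "S1 \<inter> S2 = {a, b}" "S1 \<inter> S3 = {a, b}" "S2 \<inter> S3 = {a, b}"
    and K: "S1 \<union> S2 \<union> S3 \<subseteq> K"
    and m2: "m2 \<in> S2 - {a, b}" "m2 \<in> closure (outside K)"
    and m3: "m3 \<in> S3 - {a, b}" "m3 \<in> closure (outside K)"
  shows "S1 - {a, b} \<subseteq> inside (S2 \<union> S3)"
proof -
  have cl: "closed (S1 \<union> S2)" "closed (S1 \<union> S3)"
    using arc_between_facts(4)[OF a1] arc_between_facts(4)[OF a2] arc_between_facts(4)[OF a3]
    by (auto simp: compact_imp_closed)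
  have "m2 \<notin> inside (S1 \<union> S3)" "m3 \<notin> inside (S1 \<union> S2)"
    using inside_not_in_closure_outside[OF _ cl(2)] inside_not_in_closure_outside[OF _ cl(1)] m2 m3 K
    by auto
  with theta_arc_inside[OF a1 a2 a3 i] m2 m3 show ?thesis by blast
qed

lemma theta_not_outer:
  assumes a1: "arc_between S1 a b" and a2: "arc_between S2 a b" and a3: "arc_between S3 a b"
    and i: "S1 \<inter> S2 = {a, b}" "S1 \<inter> S3 = {a, b}" "S2 \<inter> S3 = {a, b}"
    and K: "S1 \<union> S2 \<union> S3 \<subseteq> K"
    and m: "m1 \<in> S1 - {a, b}" "m2 \<in> S2 - {a, b}" "m3 \<in> S3 - {a, b}"
  shows "\<not> {m1, m2, m3} \<subseteq> closure (outside K)"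
proof
  assume out: "{m1, m2, m3} \<subseteq> closure (outside K)"
  have "S1 - {a, b} \<subseteq> inside (S2 \<union> S3)"
    by (rule theta_middle_hidden[OF a1 a2 a3 i K, of m2 m3]) (use m out in auto)
  then have "m1 \<in> inside (S2 \<union> S3)" using m by blast
  moreover have "closed (S2 \<union> S3)"
    using arc_between_facts(4)[OF a2] arc_between_facts(4)[OF a3] by (auto simp: compact_imp_closed)
  ultimately show False
    using inside_not_in_closure_outside[of m1 "S2 \<union> S3" K] K out by auto
qed

text \<open>By the theta argument both diagonals \<open>Sab\<close> and \<open>Scu\<close> run
  inside the 4-cycle through \<open>a\<close>, \<open>u\<close>, \<open>b\<close>, \<open>c\<close>.
  The first cuts this inside in two, and the second stays in one half. One end of \<open>Scu\<close>
  is not on the boundary of that half, so it is enclosed by it.\<close>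

lemma K4_not_outer:
  assumes ab: "arc_between Sab a b" and au: "arc_between Sau a u" and ac: "arc_between Sac a c"
    and bu: "arc_between Sbu b u" and bc: "arc_between Sbc b c" and uc: "arc_between Scu u c"
    and i: "Sab \<inter> Sau \<subseteq> {a}" "Sab \<inter> Sac \<subseteq> {a}" "Sab \<inter> Sbu \<subseteq> {b}" "Sab \<inter> Sbc \<subseteq> {b}" "Sab \<inter> Scu = {}"
      "Sau \<inter> Sac \<subseteq> {a}" "Sau \<inter> Sbu \<subseteq> {u}" "Sau \<inter> Sbc = {}" "Sau \<inter> Scu \<subseteq> {u}"
      "Sac \<inter> Sbu = {}" "Sac \<inter> Sbc \<subseteq> {c}" "Sac \<inter> Scu \<subseteq> {c}"
      "Sbu \<inter> Sbc \<subseteq> {b}" "Sbu \<inter> Scu \<subseteq> {u}" "Sbc \<inter> Scu \<subseteq> {c}"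
    and K: "Sab \<union> Sau \<union> Sac \<union> Sbu \<union> Sbc \<union> Scu \<subseteq> K"
  shows "\<not> {a, b, c, u} \<subseteq> closure (outside K)"
proof
  assume out: "{a, b, c, u} \<subseteq> closure (outside K)"
  note m = arc_between_facts(1-3)[OF ab] arc_between_facts(1-3)[OF au] arc_between_facts(1-3)[OF ac]
    arc_between_facts(1-3)[OF bu] arc_between_facts(1-3)[OF bc] arc_between_facts(1-3)[OF uc]
  have aub: "arc_between (Sau \<union> Sbu) a b"
    by (rule arc_between_join[OF au arc_between_sym[OF bu] i(7)])
  have acb: "arc_between (Sac \<union> Sbc) a b"
    by (rule arc_between_join[OF ac arc_between_sym[OF bc] i(11)])
  have uac: "arc_between (Sau \<union> Sac) u c"
    by (rule arc_between_join[OF arc_between_sym[OF au] ac i(6)])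
  have ubc: "arc_between (Sbu \<union> Sbc) u c"
    by (rule arc_between_join[OF arc_between_sym[OF bu] bc i(13)])
  have i1: "Sab \<inter> (Sau \<union> Sbu) = {a, b}" "Sab \<inter> (Sac \<union> Sbc) = {a, b}"
    "(Sau \<union> Sbu) \<inter> (Sac \<union> Sbc) = {a, b}"
    using i(1,3) m(1,2,4,10) apply blast
    using i(2,4) m(1,2,7,13) apply blast
    using i(6,8,10,13) m(4,7,10,13) by blast
  have i2: "Scu \<inter> (Sau \<union> Sac) = {u, c}" "Scu \<inter> (Sbu \<union> Sbc) = {u, c}"
    "(Sau \<union> Sac) \<inter> (Sbu \<union> Sbc) = {u, c}"
    using i(9,12) m(5,8,16,17) apply blast
    using i(14,15) m(11,14,16,17) apply blast
    using i(7,8,10,11) m(5,8,11,14) by blast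
  let ?C = "(Sau \<union> Sbu) \<union> (Sac \<union> Sbc)"
  have ab_in: "Sab - {a, b} \<subseteq> inside ?C"
    by (rule theta_middle_hidden[OF ab aub acb i1, of K u c]) (use K m out in auto)
  have "Scu - {u, c} \<subseteq> inside ((Sau \<union> Sac) \<union> (Sbu \<union> Sbc))"
    by (rule theta_middle_hidden[OF uc uac ubc i2, of K a b]) (use K m out in auto)
  also have "(Sau \<union> Sac) \<union> (Sbu \<union> Sbc) = ?C" by blast
  finally have uc_in: "Scu - {u, c} \<subseteq> inside ?C" .
  obtain g h k where g: "arc g" "path_image g = Sau \<union> Sbu" "pathstart g = a" "pathfinish g = b"
    and h: "arc h" "path_image h = Sac \<union> Sbc" "pathstart h = a" "pathfinish h = b"
    and k: "arc k" "path_image k = Sab" "pathstart k = a" "pathfinish k = b"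
    using ab aub acb by (auto simp: arc_between_def)
  have "Sab \<inter> inside ?C \<noteq> {}" using ab_in arc_between_facts(8)[OF ab] by blast
  then have split: "inside (Sau \<union> Sbu \<union> Sab) \<inter> inside (Sac \<union> Sbc \<union> Sab) = {}"
    "inside (Sau \<union> Sbu \<union> Sab) \<union> inside (Sac \<union> Sbc \<union> Sab) \<union> (Sab - {a, b}) = inside ?C"
    using split_inside_simple_closed_curve[of g a b h k] g h k m(3) i1
    by (auto simp: arc_imp_simple_path Int_commute)
  have i1': "(Sau \<union> Sbu) \<inter> Sab = {a, b}" "(Sac \<union> Sbc) \<inter> Sab = {a, b}" using i1 by auto
  note j1 = jordan_two_arcs[OF aub ab i1'(1)] and j2 = jordan_two_arcs[OF acb ab i1'(2)]
  have "Scu - {u, c} \<subseteq> inside (Sau \<union> Sbu \<union> Sab) \<or> Scu - {u, c} \<subseteq> inside (Sac \<union> Sbc \<union> Sab)"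
    using connectedD[OF arc_between_facts(6)[OF uc] j1(1) j2(1)] split uc_in i(5) by blast
  then show False
  proof
    assume A: "Scu - {u, c} \<subseteq> inside (Sau \<union> Sbu \<union> Sab)"
    have "c \<in> closure (inside (Sau \<union> Sbu \<union> Sab))"
      using arc_between_facts(7)[OF uc] m(17) closure_mono[OF A] by blast
    then have "c \<in> inside (Sau \<union> Sbu \<union> Sab)"
      unfolding closure_Un_frontier j1(6) using i(5,9,14) m(17,18) by blast
    moreover have "closed (Sau \<union> Sbu \<union> Sab)"
      using arc_between_facts(4)[OF aub] arc_between_facts(4)[OF ab] by (auto simp: compact_imp_closed)
    ultimately show False using inside_not_in_closure_outside[of c "Sau \<union> Sbu \<union> Sab" K] K out by auto
  next
    assume A: "Scu - {u, c} \<subseteq> inside (Sac \<union> Sbc \<union> Sab)"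
    have "u \<in> closure (inside (Sac \<union> Sbc \<union> Sab))"
      using arc_between_facts(7)[OF uc] m(16) closure_mono[OF A] by blast
    then have "u \<in> inside (Sac \<union> Sbc \<union> Sab)"
      unfolding closure_Un_frontier j2(6) using i(5,12,15) m(16,18) by blast
    moreover have "closed (Sac \<union> Sbc \<union> Sab)"
      using arc_between_facts(4)[OF acb] arc_between_facts(4)[OF ab] by (auto simp: compact_imp_closed)
    ultimately show False using inside_not_in_closure_outside[of u "Sac \<union> Sbc \<union> Sab" K] K out by auto
  qed
qed

section \<open>Paths of a graph as arcs of its drawing\<close>

fun path_edges :: "'a list \<Rightarrow> 'a set set" where
  "path_edges (a # b # vs) = insert {a, b} (path_edges (b # vs))"
| "path_edges _ = {}"

definition path_between :: "'a ugraph \<Rightarrow> 'a \<Rightarrow> 'a list \<Rightarrow> 'a \<Rightarrow> bool" where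
  "path_between G a vs b \<longleftrightarrow>
     distinct vs \<and> 2 \<le> length vs \<and> path_edges vs \<subseteq> edges G \<and> hd vs = a \<and> last vs = b"

definition edge_points :: "('a set \<Rightarrow> real \<Rightarrow> complex) \<Rightarrow> 'a set set \<Rightarrow> complex set" where
  "edge_points \<gamma> E = (\<Union>e\<in>E. path_image (\<gamma> e))"

lemma Union_path_edges: "\<Union> (path_edges vs) \<subseteq> set vs"
  by (induction vs rule: path_edges.induct) auto

lemma edge_points_Int:
  assumes "plane_drawing G p \<gamma>" "E \<subseteq> edges G" "E' \<subseteq> edges G" "E \<inter> E' = {}"
  shows "edge_points \<gamma> E \<inter> edge_points \<gamma> E' \<subseteq> p ` (\<Union> E \<inter> \<Union> E')"
proof
  fix z assume "z \<in> edge_points \<gamma> E \<inter> edge_points \<gamma> E'"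
  then obtain e f where ef: "e \<in> E" "f \<in> E'" "z \<in> path_image (\<gamma> e)" "z \<in> path_image (\<gamma> f)"
    by (auto simp: edge_points_def)
  with assms have "e \<noteq> f" "e \<in> edges G" "f \<in> edges G" by auto
  then have "z \<in> p ` (e \<inter> f)"
    using assms(1) ef unfolding plane_drawing_def by blast
  then show "z \<in> p ` (\<Union> E \<inter> \<Union> E')" using ef by blast
qed

lemma edge_arc_between:
  assumes "plane_drawing G p \<gamma>" "{a, b} \<in> edges G"
  shows "arc_between (path_image (\<gamma> {a, b})) (p a) (p b)"
proof -
  have g: "arc (\<gamma> {a, b})" "{pathstart (\<gamma> {a, b}), pathfinish (\<gamma> {a, b})} = {p a, p b}"
    using assms unfolding plane_drawing_def by auto
  then consider "pathstart (\<gamma> {a, b}) = p a" "pathfinish (\<gamma> {a, b}) = p b"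
    | "pathstart (\<gamma> {a, b}) = p b" "pathfinish (\<gamma> {a, b}) = p a"
    by (auto simp: doubleton_eq_iff)
  then show ?thesis
  proof cases
    case 1 then show ?thesis using g(1) by (auto simp: arc_between_def)
  next
    case 2 then have "arc_between (path_image (\<gamma> {a, b})) (p b) (p a)" using g(1) by (auto simp: arc_between_def)
    then show ?thesis by (rule arc_between_sym)
  qed
qed

lemma path_arc_between:
  assumes d: "plane_drawing G p \<gamma>"
  shows "distinct vs \<Longrightarrow> 2 \<le> length vs \<Longrightarrow> path_edges vs \<subseteq> edges G \<Longrightarrow>
    arc_between (edge_points \<gamma> (path_edges vs)) (p (hd vs)) (p (last vs))"
proof (induction vs rule: path_edges.induct)
  case (1 a b vs)
  have ab: "arc_between (path_image (\<gamma> {a, b})) (p a) (p b)"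
    using edge_arc_between[OF d] 1 by simp
  show ?case
  proof (cases vs)
    case Nil then show ?thesis using ab by (simp add: edge_points_def)
  next
    case (Cons c ws)
    have a: "a \<notin> \<Union> (path_edges (b # vs))" using Union_path_edges[of "b # vs"] 1 by auto
    have IH: "arc_between (edge_points \<gamma> (path_edges (b # vs))) (p b) (p (last (b # vs)))"
      using 1 Cons by simp
    have "edge_points \<gamma> {{a, b}} \<inter> edge_points \<gamma> (path_edges (b # vs))
        \<subseteq> p ` (\<Union> {{a, b}} \<inter> \<Union> (path_edges (b # vs)))"
      by (rule edge_points_Int[OF d]) (use "1.prems"(3) a in auto)
    also have "\<dots> \<subseteq> {p b}" using a by auto
    finally have "path_image (\<gamma> {a, b}) \<inter> edge_points \<gamma> (path_edges (b # vs)) \<subseteq> {p b}"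
      by (simp add: edge_points_def)
    from arc_between_join[OF ab IH this] show ?thesis by (simp add: edge_points_def)
  qed
qed auto

lemma path_between_arc:
  assumes "plane_drawing G p \<gamma>" "path_between G a vs b"
  shows "arc_between (edge_points \<gamma> (path_edges vs)) (p a) (p b)"
  using path_arc_between[OF assms(1), of vs] assms(2) by (auto simp: path_between_def)

text \<open>A shared edge would have both ends in \<open>S\<close>. So the paths are edge-disjoint,
  and their drawings meet in shared vertices only.\<close>

lemma paths_points_Int:
  assumes "simple_graph G" "plane_drawing G p \<gamma>" "path_between G a vs b" "path_between G c ws d"
    "set vs \<inter> set ws \<subseteq> S" "\<not> (\<exists>e\<in>edges G. e \<subseteq> S)"
  shows "edge_points \<gamma> (path_edges vs) \<inter> edge_points \<gamma> (path_edges ws) \<subseteq> p ` S"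
proof -
  have "path_edges vs \<inter> path_edges ws = {}"
  proof (rule equals0I)
    fix e assume e: "e \<in> path_edges vs \<inter> path_edges ws"
    then have "e \<subseteq> set vs" "e \<subseteq> set ws" using Union_path_edges[of vs] Union_path_edges[of ws] by auto
    moreover have "e \<in> edges G" using e assms(3) by (auto simp: path_between_def)
    ultimately show False using assms(5,6) by (meson Int_greatest order_trans)
  qed
  then have "edge_points \<gamma> (path_edges vs) \<inter> edge_points \<gamma> (path_edges ws)
      \<subseteq> p ` (\<Union> (path_edges vs) \<inter> \<Union> (path_edges ws))"
    using assms(3,4) by (intro edge_points_Int[OF assms(2)]) (auto simp: path_between_def)
  also have "\<dots> \<subseteq> p ` S"
    using Union_path_edges[of vs] Union_path_edges[of ws] assms(5) by (intro image_mono) auto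
  finally show ?thesis .
qed

lemma paths_points_Int_singleton:
  assumes "simple_graph G" "plane_drawing G p \<gamma>" "path_between G a vs b" "path_between G c ws d"
    "set vs \<inter> set ws \<subseteq> {x}"
  shows "edge_points \<gamma> (path_edges vs) \<inter> edge_points \<gamma> (path_edges ws) \<subseteq> {p x}"
proof -
  have "\<not> (\<exists>e\<in>edges G. e \<subseteq> {x})"
    using assms(1) by (auto simp: simple_graph_def subset_singleton_iff)
  from paths_points_Int[OF assms this] show ?thesis by simp
qed

lemma paths_points_Int_empty:
  assumes "simple_graph G" "plane_drawing G p \<gamma>" "path_between G a vs b" "path_between G c ws d"
    "set vs \<inter> set ws = {}"
  shows "edge_points \<gamma> (path_edges vs) \<inter> edge_points \<gamma> (path_edges ws) = {}"
proof -
  have "\<not> (\<exists>e\<in>edges G. e \<subseteq> {})" using assms(1) by (auto simp: simple_graph_def)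
  from paths_points_Int[OF assms(1-4) _ this] assms(5) show ?thesis by simp
qed

lemma path_between_ends:
  assumes "simple_graph G" "path_between G a vs b"
  shows "a \<in> verts G" "b \<in> verts G"
proof -
  have "set vs \<subseteq> verts G"
  proof -
    have "2 \<le> length us \<Longrightarrow> path_edges us \<subseteq> edges G \<Longrightarrow> set us \<subseteq> verts G" for us
    proof (induction us rule: path_edges.induct)
      case (1 a b us)
      then show ?case using assms(1) by (cases us) (auto simp: simple_graph_def)
    qed auto
    with assms(2) show ?thesis by (simp add: path_between_def)
  qed
  moreover have "vs \<noteq> []" using assms(2) by (auto simp: path_between_def)
  ultimately have "hd vs \<in> verts G" "last vs \<in> verts G"
    using hd_in_set[of vs] last_in_set[of vs] by blast+
  then show "a \<in> verts G" "b \<in> verts G" using assms(2) by (simp_all add: path_between_def)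
qed

text \<open>Paths instead of edges are needed because in both uses, the degree bound and the
  exclusion of wheels, some branch vertices are joined along a stretch of a longer path.\<close>

lemma outerplanar_no_K4_subdivision:
  assumes "simple_graph G" "outerplanar G"
    and ab: "path_between G a Pab b" and au: "path_between G a Pau u" and ac: "path_between G a Pac c"
    and bu: "path_between G b Pbu u" and bc: "path_between G b Pbc c" and uc: "path_between G u Puc c"
    and i: "set Pab \<inter> set Pau \<subseteq> {a}" "set Pab \<inter> set Pac \<subseteq> {a}" "set Pab \<inter> set Pbu \<subseteq> {b}"
      "set Pab \<inter> set Pbc \<subseteq> {b}" "set Pab \<inter> set Puc = {}"
      "set Pau \<inter> set Pac \<subseteq> {a}" "set Pau \<inter> set Pbu \<subseteq> {u}" "set Pau \<inter> set Pbc = {}" "set Pau \<inter> set Puc \<subseteq> {u}"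
      "set Pac \<inter> set Pbu = {}" "set Pac \<inter> set Pbc \<subseteq> {c}" "set Pac \<inter> set Puc \<subseteq> {c}"
      "set Pbu \<inter> set Pbc \<subseteq> {b}" "set Pbu \<inter> set Puc \<subseteq> {u}" "set Pbc \<inter> set Puc \<subseteq> {c}"
  shows False
proof -
  obtain p \<gamma> where d: "plane_drawing G p \<gamma>"
    and o: "\<And>v. v \<in> verts G \<Longrightarrow> p v \<in> frontier (outside (drawing_points G p \<gamma>))"
    using assms(2) unfolding outerplanar_def by blast
  note P = path_between_arc[OF d]
  note I1 = paths_points_Int_singleton[OF assms(1) d]
  note I0 = paths_points_Int_empty[OF assms(1) d]
  let ?S = "\<lambda>vs. edge_points \<gamma> (path_edges vs)"
  have S: "?S vs \<subseteq> drawing_points G p \<gamma>" if "path_between G x vs y" for x vs y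
    using that unfolding path_between_def edge_points_def drawing_points_def by blast
  have K: "?S Pab \<union> ?S Pau \<union> ?S Pac \<union> ?S Pbu \<union> ?S Pbc \<union> ?S Puc \<subseteq> drawing_points G p \<gamma>"
    by (intro Un_least S[OF ab] S[OF au] S[OF ac] S[OF bu] S[OF bc] S[OF uc])
  have "\<not> {p a, p b, p c, p u} \<subseteq> closure (outside (drawing_points G p \<gamma>))"
    by (rule K4_not_outer[OF P[OF ab] P[OF au] P[OF ac] P[OF bu] P[OF bc] P[OF uc]
      I1[OF ab au i(1)] I1[OF ab ac i(2)] I1[OF ab bu i(3)] I1[OF ab bc i(4)] I0[OF ab uc i(5)]
      I1[OF au ac i(6)] I1[OF au bu i(7)] I0[OF au bc i(8)] I1[OF au uc i(9)]
      I0[OF ac bu i(10)] I1[OF ac bc i(11)] I1[OF ac uc i(12)]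
      I1[OF bu bc i(13)] I1[OF bu uc i(14)] I1[OF bc uc i(15)] K])
  moreover have "{a, b, c, u} \<subseteq> verts G"
    using path_between_ends[OF assms(1) ab] path_between_ends[OF assms(1) uc] by auto
  ultimately show False using o unfolding frontier_def by blast
qed

lemma nbrs_facts:
  assumes "simple_graph G" "w \<in> nbrs G v"
  shows "w \<noteq> v" "v \<in> verts G" "w \<in> verts G" "v \<in> nbrs G w" "{v, w} \<in> edges G" "{w, v} \<in> edges G"
proof -
  show e: "{v, w} \<in> edges G" using assms(2) by (simp add: nbrs_def)
  with assms(1) have "card {v, w} = 2" "{v, w} \<subseteq> verts G" by (auto simp: simple_graph_def)
  then show "w \<noteq> v" "v \<in> verts G" "w \<in> verts G" by auto
  show "v \<in> nbrs G w" "{w, v} \<in> edges G" using e by (auto simp: nbrs_def insert_commute)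
qed

lemma nbrs_subset: "simple_graph G \<Longrightarrow> nbrs G v \<subseteq> verts G"
  by (intro subsetI nbrs_facts(3))

lemma finite_nbrs: "simple_graph G \<Longrightarrow> finite (nbrs G v)"
  using nbrs_subset[of G v] by (auto simp: simple_graph_def intro: finite_subset)

lemma outerplanar_no_K23:
  assumes G: "simple_graph G" "outerplanar G"
    and "a \<noteq> b" and m: "m1 \<in> nbrs G a \<inter> nbrs G b" "m2 \<in> nbrs G a \<inter> nbrs G b" "m3 \<in> nbrs G a \<inter> nbrs G b"
    and dm: "m1 \<noteq> m2" "m1 \<noteq> m3" "m2 \<noteq> m3"
  shows False
proof -
  obtain p \<gamma> where d: "plane_drawing G p \<gamma>"
    and o: "\<And>v. v \<in> verts G \<Longrightarrow> p v \<in> frontier (outside (drawing_points G p \<gamma>))"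
    using G(2) unfolding outerplanar_def by blast
  let ?S = "\<lambda>m. edge_points \<gamma> (path_edges [a, m, b])"
  have path: "path_between G a [a, m, b] b" if "m \<in> nbrs G a \<inter> nbrs G b" for m
    using nbrs_facts[OF G(1), of m a] nbrs_facts[OF G(1), of m b] that \<open>a \<noteq> b\<close>
    by (auto simp: path_between_def)
  have arc: "arc_between (?S m) (p a) (p b)" if "m \<in> nbrs G a \<inter> nbrs G b" for m
    using path_between_arc[OF d path[OF that]] .
  have int: "?S m \<inter> ?S m' = {p a, p b}"
    if m: "m \<in> nbrs G a \<inter> nbrs G b" "m' \<in> nbrs G a \<inter> nbrs G b" "m \<noteq> m'" for m m'
  proof
    have *: "path_edges [a, m, b] \<inter> path_edges [a, m', b] = {}"
      using path[OF m(1)] path[OF m(2)] m(3) by (auto simp: path_between_def doubleton_eq_iff)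
    have "?S m \<inter> ?S m' \<subseteq> p ` (\<Union> (path_edges [a, m, b]) \<inter> \<Union> (path_edges [a, m', b]))"
      using path[OF m(1)] path[OF m(2)] * by (intro edge_points_Int[OF d]) (auto simp: path_between_def)
    also have "\<dots> \<subseteq> {p a, p b}" using m(3) by auto
    finally show "?S m \<inter> ?S m' \<subseteq> {p a, p b}" .
    show "{p a, p b} \<subseteq> ?S m \<inter> ?S m'"
      using arc_between_facts(1,2)[OF arc[OF m(1)]] arc_between_facts(1,2)[OF arc[OF m(2)]] by blast
  qed
  have mid: "p m \<in> ?S m - {p a, p b}" if m: "m \<in> nbrs G a \<inter> nbrs G b" for m
  proof -
    note f = nbrs_facts[OF G(1), of m a] nbrs_facts[OF G(1), of m b]
    have "p m \<in> path_image (\<gamma> {a, m})"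
      using arc_between_facts(2)[OF edge_arc_between[OF d, of a m]] m f by auto
    moreover have "p m \<noteq> p a" "p m \<noteq> p b"
    proof -
      have "inj_on p (verts G)" using d unfolding plane_drawing_def by blast
      then show "p m \<noteq> p a" "p m \<noteq> p b" using m f by (auto dest: inj_onD)
    qed
    ultimately show ?thesis by (simp add: edge_points_def)
  qed
  have S: "?S m \<subseteq> drawing_points G p \<gamma>" if "m \<in> nbrs G a \<inter> nbrs G b" for m
    using path[OF that] unfolding path_between_def edge_points_def drawing_points_def by blast
  have "?S m1 \<union> ?S m2 \<union> ?S m3 \<subseteq> drawing_points G p \<gamma>"
    by (intro Un_least S m)
  from theta_not_outer[OF arc[OF m(1)] arc[OF m(2)] arc[OF m(3)] int[OF m(1,2) dm(1)]
      int[OF m(1,3) dm(2)] int[OF m(2,3) dm(3)] this mid[OF m(1)] mid[OF m(2)] mid[OF m(3)]]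
  have "\<not> {p m1, p m2, p m3} \<subseteq> closure (outside (drawing_points G p \<gamma>))" .
  moreover have "{m1, m2, m3} \<subseteq> verts G" using nbrs_subset[OF G(1)] m by blast
  ultimately show False using o unfolding frontier_def by blast
qed

lemma outerplanar_card_common_nbrs:
  assumes G: "simple_graph G" "outerplanar G" and "a \<noteq> b"
  shows "card (nbrs G a \<inter> nbrs G b) \<le> 2"
proof (rule ccontr)
  assume "\<not> ?thesis"
  then have "3 \<le> card (nbrs G a \<inter> nbrs G b)" by simp
  then obtain T where T: "T \<subseteq> nbrs G a \<inter> nbrs G b" "card T = 3" by (meson obtain_subset_with_card_n)
  then obtain x y z where "T = {x, y, z}" "x \<noteq> y" "x \<noteq> z" "y \<noteq> z" by (auto simp: card_3_iff)
  with T(1) outerplanar_no_K23[OF assms, of x y z] show False by blast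
qed

section \<open>Sparsity and neighbourhoods\<close>

lemma path_edges_nth: "path_edges vs = {{vs ! i, vs ! Suc i} |i. Suc i < length vs}"
proof (induction vs rule: path_edges.induct)
  case (1 a b vs)
  have "{{(a # b # vs) ! i, (a # b # vs) ! Suc i} |i. Suc i < length (a # b # vs)} =
    insert {a, b} {{(b # vs) ! i, (b # vs) ! Suc i} |i. Suc i < length (b # vs)}" (is "?L = ?R")
  proof
    show "?L \<subseteq> ?R"
    proof
      fix e assume "e \<in> ?L"
      then obtain i where i: "Suc i < length (a # b # vs)" "e = {(a # b # vs) ! i, (a # b # vs) ! Suc i}"
        by blast
      then show "e \<in> ?R" by (cases i) auto
    qed
    show "?R \<subseteq> ?L"
    proof
      fix e assume "e \<in> ?R"
      then consider "e = {a, b}"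
        | i where "Suc i < length (b # vs)" "e = {(b # vs) ! i, (b # vs) ! Suc i}" by blast
      then show "e \<in> ?L"
      proof cases
        case 1 then show ?thesis by (auto intro!: exI[of _ 0])
      next
        case (2 i) then show ?thesis by (auto intro!: exI[of _ "Suc i"])
      qed
    qed
  qed
  with 1 show ?case by simp
qed auto

lemma path_edges_subset_iff:
  "path_edges vs \<subseteq> E \<longleftrightarrow> (\<forall>i. Suc i < length vs \<longrightarrow> {vs ! i, vs ! Suc i} \<in> E)"
  by (auto simp: path_edges_nth)

text \<open>All paths of a subdivision will run through vertices of one fixed path. Naming them by
  positions turns disjointness into comparisons of natural numbers.\<close>

lemma path_between_indices:
  assumes vs: "distinct vs" and ks: "distinct ks" "2 \<le> length ks" "set ks \<subseteq> {..<length vs}"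
    and E: "\<And>i. Suc i < length ks \<Longrightarrow> {vs ! (ks ! i), vs ! (ks ! Suc i)} \<in> edges G"
  shows "path_between G (vs ! hd ks) (map ((!) vs) ks) (vs ! last ks)"
proof -
  have "inj_on ((!) vs) (set ks)"
    using inj_on_nth[OF vs, of "set ks"] ks(3) by auto
  then have "distinct (map ((!) vs) ks)" using ks(1) by (simp add: distinct_map)
  moreover have "ks \<noteq> []" using ks(2) by auto
  moreover have "path_edges (map ((!) vs) ks) \<subseteq> edges G"
    unfolding path_edges_subset_iff using E by simp
  ultimately show ?thesis using ks(2) by (simp add: path_between_def hd_map last_map)
qed

lemma indices_Int:
  assumes "distinct vs" "set ks \<subseteq> {..<length vs}" "set ls \<subseteq> {..<length vs}" "set ks \<inter> set ls \<subseteq> Z"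
  shows "set (map ((!) vs) ks) \<inter> set (map ((!) vs) ls) \<subseteq> (!) vs ` Z"
proof -
  have "inj_on ((!) vs) {..<length vs}" using inj_on_nth[OF assms(1)] by auto
  then have "(!) vs ` set ks \<inter> (!) vs ` set ls = (!) vs ` (set ks \<inter> set ls)"
    using inj_on_image_Int[of "(!) vs" "{..<length vs}" "set ks" "set ls"] assms(2,3) by simp
  then show ?thesis using assms(4) by auto
qed

section \<open>Longest paths, 2-degeneracy and the shape of neighbourhoods\<close>

definition path_in :: "'a ugraph \<Rightarrow> 'a set \<Rightarrow> 'a list \<Rightarrow> bool" where
  "path_in G S vs \<longleftrightarrow> distinct vs \<and> vs \<noteq> [] \<and> set vs \<subseteq> S \<and> path_edges vs \<subseteq> edges G"

definition longest_path_in :: "'a ugraph \<Rightarrow> 'a set \<Rightarrow> 'a list \<Rightarrow> bool" where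
  "longest_path_in G S vs \<longleftrightarrow> path_in G S vs \<and> (\<forall>ws. path_in G S ws \<longrightarrow> length ws \<le> length vs)"

lemma longest_path_exists:
  assumes "finite S" "S \<noteq> {}"
  obtains vs where "longest_path_in G S vs"
proof -
  obtain v where "v \<in> S" using assms(2) by blast
  then have "path_in G S [v]" by (simp add: path_in_def)
  moreover have "\<forall>ws. path_in G S ws \<longrightarrow> length ws < Suc (card S)"
    using assms(1) by (auto simp: path_in_def less_Suc_eq_le distinct_card[symmetric] intro: card_mono)
  ultimately show ?thesis
    using ex_has_greatest_nat[of "path_in G S" "[v]" length "Suc (card S)"] that
    unfolding longest_path_in_def by blast
qed

lemma longest_path_hd_nbrs:
  assumes "longest_path_in G S vs"
  shows "nbrs G (vs ! 0) \<inter> S \<subseteq> set vs"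
proof
  fix w assume w: "w \<in> nbrs G (vs ! 0) \<inter> S"
  show "w \<in> set vs"
  proof (rule ccontr)
    assume "w \<notin> set vs"
    moreover obtain a us where vs: "vs = a # us" using assms by (cases vs) (auto simp: longest_path_in_def path_in_def)
    ultimately have "path_in G S (w # vs)"
      using assms w by (auto simp: longest_path_in_def path_in_def nbrs_def insert_commute)
    then show False using assms by (fastforce simp: longest_path_in_def)
  qed
qed

lemma path_edges_rev: "path_edges (rev vs) = path_edges vs"
proof -
  have "path_edges (rev us) \<subseteq> path_edges us" for us :: "'a list"
  proof (unfold path_edges_subset_iff, intro allI impI)
    fix i assume i: "Suc i < length (rev us)"
    define k where "k = length us - Suc (Suc i)"
    have "rev us ! i = us ! Suc k" "rev us ! Suc i = us ! k" "Suc k < length us"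
      using i by (auto simp: rev_nth k_def Suc_diff_Suc)
    then show "{rev us ! i, rev us ! Suc i} \<in> path_edges us"
      by (auto simp: path_edges_nth insert_commute)
  qed
  from this[of vs] this[of "rev vs"] show ?thesis by auto
qed

lemma longest_path_rev: "longest_path_in G S vs \<Longrightarrow> longest_path_in G S (rev vs)"
  by (auto simp: longest_path_in_def path_in_def path_edges_rev)

text \<open>All neighbours in \<open>S\<close> of the first vertex lie on a longest path. Of three
  of them, at least one remains after excluding position 1 and a freely chosen position
  \<open>i\<close>.\<close>

lemma longest_path_hd_indices:
  assumes G: "simple_graph G" and vs: "longest_path_in G S vs"
    and deg: "3 \<le> card (nbrs G (vs ! 0) \<inter> S)"
  obtains j where "j < length vs" "2 \<le> j" "j \<noteq> i" "{vs ! 0, vs ! j} \<in> edges G"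
proof -
  let ?I = "{j. j < length vs \<and> {vs ! 0, vs ! j} \<in> edges G}"
  have "nbrs G (vs ! 0) \<inter> S \<subseteq> (!) vs ` ?I"
    using longest_path_hd_nbrs[OF vs] by (force simp: in_set_conv_nth nbrs_def)
  then have "card (nbrs G (vs ! 0) \<inter> S) \<le> card ((!) vs ` ?I)" by (intro card_mono) auto
  also have "\<dots> \<le> card ?I" by (intro card_image_le) auto
  finally have "3 \<le> card ?I" using deg by simp
  then have "\<not> ?I \<subseteq> {1, i}"
    using card_mono[of "{1, i}" ?I] card_insert_le_m1[of 2 "{i}" 1] by (auto simp: card_insert_if split: if_splits)
  then obtain j where j: "j \<in> ?I" "j \<noteq> 1" "j \<noteq> i" by blast
  moreover have "j \<noteq> 0"
  proof
    assume "j = 0"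
    then have "vs ! 0 \<in> nbrs G (vs ! 0)" using j by (simp add: nbrs_def)
    then show False using nbrs_facts(1)[OF G] by blast
  qed
  ultimately show ?thesis using that by auto
qed

text \<open>If every vertex had three neighbours in \<open>S\<close>, take a longest path whose first vertex has a chord
  to position \<open>i\<close> with \<open>i\<close> as small as possible. Reversing its first \<open>i\<close> vertices gives another
  longest path, so the vertices in positions \<open>0\<close> and \<open>i - 1\<close> both have chords beyond \<open>i\<close>; these
  produce a subdivided \<open>K\<^sub>4\<close>.\<close>

lemma outerplanar_degree_le_2:
  assumes G: "simple_graph G" "outerplanar G" and S: "finite S" "S \<noteq> {}"
  shows "\<exists>v\<in>S. card (nbrs G v \<inter> S) \<le> 2"
proof (rule ccontr)
  assume "\<not> ?thesis"
  then have deg: "3 \<le> card (nbrs G v \<inter> S)" if "v \<in> S" for v using that by force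
  define Q where "Q i \<longleftrightarrow> (\<exists>vs. longest_path_in G S vs \<and> i < length vs \<and> 2 \<le> i \<and> {vs ! 0, vs ! i} \<in> edges G)" for i
  have hd_in: "vs ! 0 \<in> S" if "longest_path_in G S vs" for vs
    using that by (cases vs) (auto simp: longest_path_in_def path_in_def)
  obtain us where us: "longest_path_in G S us" using longest_path_exists[OF S] by blast
  obtain j0 where "Q j0"
    using longest_path_hd_indices[OF G(1) us deg[OF hd_in[OF us]], of 0] us unfolding Q_def by blast
  define i where "i = (LEAST i. Q i)"
  have "Q i" unfolding i_def using \<open>Q j0\<close> by (rule LeastI)
  then obtain vs where vs: "longest_path_in G S vs" and i: "i < length vs" "2 \<le> i" "{vs ! 0, vs ! i} \<in> edges G"
    unfolding Q_def by blast
  have le: "i \<le> k" if "Q k" for k unfolding i_def using that by (rule Least_le)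
  have d: "distinct vs" and E: "\<And>k. Suc k < length vs \<Longrightarrow> {vs ! k, vs ! Suc k} \<in> edges G"
    using vs by (auto simp: longest_path_in_def path_in_def path_edges_subset_iff)
  obtain j where j: "j < length vs" "2 \<le> j" "j \<noteq> i" "{vs ! 0, vs ! j} \<in> edges G"
    using longest_path_hd_indices[OF G(1) vs deg[OF hd_in[OF vs]]] by blast
  then have "Q j" using vs unfolding Q_def by blast
  then have ij: "i < j" using le[of j] j(3) by simp
  \<comment> \<open>Start at position \<open>i - 1\<close>, walk back to 0 and cross the chord to
    \<open>i\<close>: the chord replaces the path edge from \<open>i - 1\<close> to
    \<open>i\<close>.\<close>
  define ws where "ws = rev (take i vs) @ drop i vs"
  have wsn: "ws ! k = (if k < i then vs ! (i - Suc k) else vs ! k)" if "k < length vs" for k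
    using that i by (auto simp: ws_def nth_append rev_nth)
  have lws: "length ws = length vs" using i by (simp add: ws_def)
  have "set ws = set vs" by (metis append_take_drop_id set_append set_rev ws_def)
  moreover have "distinct ws" using d lws \<open>set ws = set vs\<close> by (metis card_distinct distinct_card)
  moreover have "path_edges ws \<subseteq> edges G"
    unfolding path_edges_subset_iff
  proof (intro allI impI)
    fix k assume k: "Suc k < length ws"
    consider "Suc k < i" | "Suc k = i" | "i \<le> k" by linarith
    then show "{ws ! k, ws ! Suc k} \<in> edges G"
    proof cases
      case 1
      then have "i - Suc k = Suc (i - Suc (Suc k))" by simp
      then show ?thesis using 1 k lws i E[of "i - Suc (Suc k)"] by (simp add: wsn insert_commute)
    next
      case 2 then show ?thesis using k lws i by (simp add: wsn)
    next
      case 3 then show ?thesis using k lws E[of k] by (simp add: wsn)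
    qed
  qed
  ultimately have ws: "longest_path_in G S ws"
    using vs lws by (auto simp: longest_path_in_def path_in_def)
  \<comment> \<open>Position \<open>i\<close> is excluded because it is the old path neighbour of
    the new first vertex; minimality of \<open>i\<close> then pushes \<open>m\<close> beyond
    \<open>i\<close>.\<close>
  obtain m where m: "m < length ws" "2 \<le> m" "m \<noteq> i" "{ws ! 0, ws ! m} \<in> edges G"
    using longest_path_hd_indices[OF G(1) ws deg[OF hd_in[OF ws]]] by blast
  then have "Q m" using ws unfolding Q_def by blast
  then have im: "i < m" using le[of m] m(3) by simp
  have mE: "{vs ! (i - 1), vs ! m} \<in> edges G"
    using m(1,4) im i lws wsn[of 0] wsn[of m] by (cases "length vs") auto
  \<comment> \<open>The branch vertices are at positions 0, \<open>i - 1\<close>, \<open>i\<close>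
    and \<open>M\<close>. The chords from 0 and \<open>i - 1\<close> may end at different positions
    \<open>j\<close> and \<open>m\<close>; the farther end is followed back along the path to
    \<open>M\<close>, so at least one of \<open>Pac\<close> and \<open>Pbc\<close> is a single
    chord.\<close>
  define M where "M = min j m"
  have M: "i < M" "M \<le> j" "M \<le> m" "M < length vs" using ij im j(1) by (auto simp: M_def)
  have m': "m < length vs" using m(1) lws by simp
  define Pab where "Pab = [0..<i]"
  define Pau where "Pau = [0, i]"
  define Pac where "Pac = 0 # rev [M..<Suc j]"
  define Pbu where "Pbu = [i - 1, i]"
  define Pbc where "Pbc = (i - 1) # rev [M..<Suc m]"
  define Puc where "Puc = [i..<Suc M]"
  note defs = Pab_def Pau_def Pac_def Pbu_def Pbc_def Puc_def
  have rev_path: "path_between G (vs ! k) (map ((!) vs) (k # rev [M..<Suc l])) (vs ! M)"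
    if k: "k < i" "{vs ! k, vs ! l} \<in> edges G" "M \<le> l" "l < length vs" for k l
  proof -
    have "path_between G (vs ! hd (k # rev [M..<Suc l])) (map ((!) vs) (k # rev [M..<Suc l]))
        (vs ! last (k # rev [M..<Suc l]))"
    proof (rule path_between_indices[OF d])
      fix q assume q: "Suc q < length (k # rev [M..<Suc l])"
      show "{vs ! ((k # rev [M..<Suc l]) ! q), vs ! ((k # rev [M..<Suc l]) ! Suc q)} \<in> edges G"
      proof (cases q)
        case 0 then show ?thesis using k by (simp add: rev_nth)
      next
        case (Suc r)
        then have r: "rev [M..<Suc l] ! r = Suc (l - Suc r)" "rev [M..<Suc l] ! Suc r = l - Suc r" "Suc (l - Suc r) < length vs"
          using q k by (auto simp: rev_nth nth_append simp del: upt_Suc)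
        then show ?thesis using E[of "l - Suc r"] Suc by (simp add: insert_commute del: upt_Suc)
      qed
    qed (use k M i in \<open>auto simp del: upt_Suc\<close>)
    moreover have "last (k # rev [M..<Suc l]) = M" using k by (simp add: last_rev hd_upt del: upt_Suc)
    ultimately show ?thesis by simp
  qed
  have sub_path: "path_between G (vs ! k) (map ((!) vs) [k..<Suc l]) (vs ! l)"
    if k: "k < l" "l < length vs" for k l
  proof -
    have "path_between G (vs ! hd [k..<Suc l]) (map ((!) vs) [k..<Suc l]) (vs ! last [k..<Suc l])"
      by (rule path_between_indices[OF d]) (use k E in \<open>auto simp del: upt_Suc\<close>)
    then show ?thesis using k by (simp add: hd_upt del: upt_Suc)
  qed
  have edge_path: "path_between G (vs ! k) (map ((!) vs) [k, l]) (vs ! l)"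
    if "k < l" "l < length vs" "{vs ! k, vs ! l} \<in> edges G" for k l
    using path_between_indices[OF d, of "[k, l]" G] that by auto
  have P: "path_between G (vs ! 0) (map ((!) vs) Pab) (vs ! (i - 1))"
    "path_between G (vs ! 0) (map ((!) vs) Pau) (vs ! i)"
    "path_between G (vs ! 0) (map ((!) vs) Pac) (vs ! M)"
    "path_between G (vs ! (i - 1)) (map ((!) vs) Pbu) (vs ! i)"
    "path_between G (vs ! (i - 1)) (map ((!) vs) Pbc) (vs ! M)"
    "path_between G (vs ! i) (map ((!) vs) Puc) (vs ! M)"
    unfolding defs
    using sub_path[of 0 "i - 1"] edge_path[of 0 i] rev_path[of 0 j] edge_path[of "i - 1" i] E[of "i - 1"]
      rev_path[of "i - 1" m] sub_path[of i M] i j M m' mE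
    by (auto simp del: upt_Suc)
  have b: "set Pab \<subseteq> {..<length vs}" "set Pau \<subseteq> {..<length vs}" "set Pac \<subseteq> {..<length vs}"
    "set Pbu \<subseteq> {..<length vs}" "set Pbc \<subseteq> {..<length vs}" "set Puc \<subseteq> {..<length vs}"
    using i j(1) m' M by (auto simp: defs simp del: upt_Suc)
  note I = indices_Int[OF d]
  have I1: "set (map ((!) vs) ks) \<inter> set (map ((!) vs) ls) \<subseteq> {vs ! z}"
    if "set ks \<subseteq> {..<length vs}" "set ls \<subseteq> {..<length vs}" "set ks \<inter> set ls \<subseteq> {z}" for ks ls z
    using I[OF that] by simp
  have I0: "set (map ((!) vs) ks) \<inter> set (map ((!) vs) ls) = {}"
    if "set ks \<subseteq> {..<length vs}" "set ls \<subseteq> {..<length vs}" "set ks \<inter> set ls = {}" for ks ls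
    using I[OF that(1,2), of "{}"] that(3) by simp
  show False
    by (rule outerplanar_no_K4_subdivision[OF G P]; (rule I1 | rule I0); (rule b)?)
      (use i ij im M in \<open>auto simp: defs M_def simp del: upt_Suc\<close>)
qed

text \<open>Removing a vertex with at most two neighbours in \<open>S\<close> costs at most 4: its
  own degree, and one for each of these neighbours.\<close>

lemma outerplanar_degree_sum:
  assumes G: "simple_graph G" "outerplanar G" and S: "finite S"
  shows "(\<Sum>v\<in>S. card (nbrs G v \<inter> S)) \<le> 4 * card S"
  using S
proof (induction "card S" arbitrary: S)
  case 0 then show ?case by simp
next
  case (Suc k)
  then have "S \<noteq> {}" by auto
  then obtain v where v: "v \<in> S" "card (nbrs G v \<inter> S) \<le> 2"
    using outerplanar_degree_le_2[OF G Suc.prems] by blast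
  let ?T = "S - {v}"
  have vv: "v \<notin> nbrs G v" using nbrs_facts(1)[OF G(1)] by blast
  have split: "card (nbrs G w \<inter> S) = card (nbrs G w \<inter> ?T) + (if w \<in> nbrs G v then 1 else 0)" for w
  proof (cases "w \<in> nbrs G v")
    case True
    then have "v \<in> nbrs G w" using nbrs_facts(4)[OF G(1)] by blast
    then have "nbrs G w \<inter> S = insert v (nbrs G w \<inter> ?T)" using v by blast
    then show ?thesis using True Suc.prems by simp
  next
    case False
    then have "v \<notin> nbrs G w" using nbrs_facts(4)[OF G(1)] by blast
    then have "nbrs G w \<inter> S = nbrs G w \<inter> ?T" by blast
    then show ?thesis using False by simp
  qed
  have "(\<Sum>w\<in>?T. card (nbrs G w \<inter> S)) =
      (\<Sum>w\<in>?T. card (nbrs G w \<inter> ?T)) + card (nbrs G v \<inter> ?T)"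
    unfolding split by (simp add: sum.distrib sum.If_cases Suc.prems Int_commute)
  moreover have "nbrs G v \<inter> ?T = nbrs G v \<inter> S" using vv by blast
  moreover from this have "card (nbrs G v \<inter> ?T) = card (nbrs G v \<inter> S)" by simp
  moreover have "(\<Sum>w\<in>?T. card (nbrs G w \<inter> ?T)) \<le> 4 * card ?T"
    using Suc v by (intro Suc.hyps(1)) auto
  moreover have "(\<Sum>w\<in>S. card (nbrs G w \<inter> S)) = card (nbrs G v \<inter> S) + (\<Sum>w\<in>?T. card (nbrs G w \<inter> S))"
    using v Suc.prems by (simp add: sum.remove)
  moreover have "Suc (card ?T) = card S" using v Suc.prems by (metis card_Suc_Diff1)
  ultimately show ?case using v(2) by linarith
qed

text \<open>The chord would give a subdivided K4 with branch vertices \<open>u\<close> and positions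
  \<open>i\<close>, \<open>i + 1\<close>, \<open>j\<close>: \<open>u\<close> is joined to the other
  three by edges, and the stretch from \<open>i + 1\<close> to \<open>j\<close> supplies the last
  path.\<close>

lemma outerplanar_no_wheel:
  assumes G: "simple_graph G" "outerplanar G" and vs: "path_in G (nbrs G u) vs"
    and ij: "i + 2 \<le> j" "j < length vs"
  shows "{vs ! i, vs ! j} \<notin> edges G"
proof
  assume e: "{vs ! i, vs ! j} \<in> edges G"
  have d: "distinct vs" and E: "\<And>k. Suc k < length vs \<Longrightarrow> {vs ! k, vs ! Suc k} \<in> edges G"
    and sub: "set vs \<subseteq> nbrs G u"
    using vs by (auto simp: path_in_def path_edges_subset_iff)
  have u: "{vs ! k, u} \<in> edges G" if "k < length vs" for k
    using nbrs_facts(6)[OF G(1), of "vs ! k" u] sub that nth_mem by blast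
  have "u \<notin> set vs" using nbrs_facts(1)[OF G(1), of u u] sub by blast
  then have nu: "vs ! k \<noteq> u" if "k < length vs" for k using that nth_mem by blast
  have vv: "vs ! k \<noteq> vs ! l" if "k < l" "l < length vs" for k l
    using d that by (simp add: nth_eq_iff_index_eq)
  have s: "path_between G (vs ! Suc i) (map ((!) vs) [Suc i..<Suc j]) (vs ! j)"
  proof -
    have "path_between G (vs ! hd [Suc i..<Suc j]) (map ((!) vs) [Suc i..<Suc j]) (vs ! last [Suc i..<Suc j])"
      by (rule path_between_indices[OF d]) (use ij E in \<open>auto simp del: upt_Suc\<close>)
    then show ?thesis using ij by (simp add: hd_upt del: upt_Suc)
  qed
  have edge: "path_between G a [a, b] b" if "{a, b} \<in> edges G" "a \<noteq> b" for a b
    using that by (simp add: path_between_def)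
  have n: "vs ! i \<notin> set (map ((!) vs) [Suc i..<Suc j])" "u \<notin> set (map ((!) vs) [Suc i..<Suc j])"
    using d ij \<open>u \<notin> set vs\<close> by (auto simp: nth_eq_iff_index_eq simp del: upt_Suc)
  show False
    by (rule outerplanar_no_K4_subdivision[OF G edge[of "vs ! i" "vs ! Suc i"] edge[of "vs ! i" u]
          edge[of "vs ! i" "vs ! j"] edge[of "vs ! Suc i" u] s edge[of u "vs ! j"]])
      (use n e ij u[of i] u[of "Suc i"] u[of j] nu[of i] nu[of "Suc i"] nu[of j] E[of i]
        vv[of i "Suc i"] vv[of i j] vv[of "Suc i" j] in \<open>auto simp: insert_commute simp del: upt_Suc\<close>)
qed

text \<open>A longest path in a neighbourhood is a whole component, without chords. A neighbour off
  the path would extend it at an end, and at an inner vertex it would be a third common neighbour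
  with \<open>u\<close>; a chord would create a wheel.\<close>

lemma outerplanar_nbhd_path_closed:
  assumes G: "simple_graph G" "outerplanar G" and T: "T \<subseteq> nbrs G u"
    and vs: "longest_path_in G T vs" and x: "x \<in> set vs" and y: "y \<in> T" and e: "{x, y} \<in> edges G"
  shows "y \<in> set vs \<and> {x, y} \<in> path_edges vs"
proof
  have d: "distinct vs" and E: "\<And>k. Suc k < length vs \<Longrightarrow> {vs ! k, vs ! Suc k} \<in> edges G" and sub: "set vs \<subseteq> T"
    using vs by (auto simp: longest_path_in_def path_in_def path_edges_subset_iff)
  have path: "path_in G (nbrs G u) vs" using vs T by (auto simp: longest_path_in_def path_in_def)
  obtain i where i: "i < length vs" "x = vs ! i" using x by (auto simp: in_set_conv_nth)
  show ys: "y \<in> set vs"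
  proof (rule ccontr)
    assume ny: "y \<notin> set vs"
    consider "i = 0" | "Suc i = length vs" | "0 < i" "Suc i < length vs" using i by linarith
    then show False
    proof cases
      case 1
      then show False using longest_path_hd_nbrs[OF vs] e y ny i by (auto simp: nbrs_def)
    next
      case 2
      then have "rev vs ! 0 = x" using i by (simp add: rev_nth flip: 2)
      then show False
        using longest_path_hd_nbrs[OF longest_path_rev[OF vs]] e y ny by (auto simp: nbrs_def)
    next
      case 3
      define T3 where "T3 = {vs ! (i - 1), vs ! Suc i, y}"
      have "vs ! (i - 1) \<noteq> vs ! Suc i" using 3 d by (simp add: nth_eq_iff_index_eq)
      moreover have "vs ! (i - 1) \<in> set vs" "vs ! Suc i \<in> set vs" using 3 by auto
      ultimately have "card T3 = 3" "T3 \<subseteq> T" using ny y sub by (auto simp: T3_def card_insert_if)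
      moreover have "T3 \<subseteq> nbrs G x"
        using E[of i] E[of "i - 1"] 3 e i by (auto simp: T3_def nbrs_def insert_commute)
      ultimately have "card T3 = 3" "T3 \<subseteq> nbrs G x \<inter> nbrs G u" using T by auto
      moreover have "x \<noteq> u" using nbrs_facts(1)[OF G(1), of x u] x sub T by blast
      ultimately show False
        using outerplanar_card_common_nbrs[OF G, of x u] card_mono[of "nbrs G x \<inter> nbrs G u" T3]
          finite_nbrs[OF G(1)] by auto
    qed
  qed
  then obtain j where j: "j < length vs" "y = vs ! j" by (auto simp: in_set_conv_nth)
  have "x \<noteq> y" using e nbrs_facts(1)[OF G(1), of y x] by (auto simp: nbrs_def)
  then have "i \<noteq> j" using i j by auto
  moreover have "\<not> i + 2 \<le> j" using outerplanar_no_wheel[OF G path, of i j] e i j by auto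
  moreover have "\<not> j + 2 \<le> i" using outerplanar_no_wheel[OF G path, of j i] e i j by (auto simp: insert_commute)
  ultimately consider "j = Suc i" | "i = Suc j" by linarith
  then show "{x, y} \<in> path_edges vs" using i j by cases (auto simp: path_edges_nth insert_commute)
qed

lemma path_edges_append: "path_edges vs \<union> path_edges ws \<subseteq> path_edges (vs @ ws)"
proof (induction vs rule: path_edges.induct)
  case ("2_2" a)
  then show ?case by (cases ws) auto
qed auto

text \<open>Longest paths are split off one after the other, which is why subsets \<open>T\<close>
  are considered. The resulting order lists the rim of the fan; consecutive vertices need not be
  adjacent, hence only an inclusion.\<close>

lemma outerplanar_nbhd_linear:
  assumes G: "simple_graph G" "outerplanar G" and T: "T \<subseteq> nbrs G u"
  shows "\<exists>vs. distinct vs \<and> set vs = T \<and> {e \<in> edges G. e \<subseteq> T} \<subseteq> path_edges vs"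
  using T
proof (induction "card T" arbitrary: T rule: less_induct)
  case less
  have fT: "finite T" using less.prems finite_nbrs[OF G(1)] finite_subset by blast
  show ?case
  proof (cases "T = {}")
    case True then show ?thesis using G(1) by (auto simp: simple_graph_def)
  next
    case False
    obtain vs where vs: "longest_path_in G T vs" using longest_path_exists[OF fT False] .
    then have vs': "distinct vs" "vs \<noteq> []" "set vs \<subseteq> T" by (auto simp: longest_path_in_def path_in_def)
    then have "T - set vs \<subset> T" using hd_in_set[of vs] by blast
    then have "card (T - set vs) < card T" using fT by (rule psubset_card_mono[rotated])
    then obtain ws where ws: "distinct ws" "set ws = T - set vs" "{e \<in> edges G. e \<subseteq> T - set vs} \<subseteq> path_edges ws"
      using less.hyps[of "T - set vs"] less.prems by auto
    have "e \<in> path_edges (vs @ ws)" if e: "e \<in> edges G" "e \<subseteq> T" for e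
    proof (cases "e \<subseteq> T - set vs")
      case True then show ?thesis using e ws(3) path_edges_append[of vs ws] by blast
    next
      case False
      obtain a b where ab: "e = {a, b}" using e G(1) by (auto simp: simple_graph_def card_2_iff)
      with False e obtain x y where "e = {x, y}" "x \<in> set vs" "y \<in> T" by (cases "a \<in> set vs") auto
      then have "e \<in> path_edges vs"
        using outerplanar_nbhd_path_closed[OF G less.prems vs] e(1) by blast
      then show ?thesis using path_edges_append[of vs ws] by blast
    qed
    then show ?thesis using vs' ws by (intro exI[of _ "vs @ ws"]) auto
  qed
qed

text \<open>Cut the list wherever two consecutive vertices do not form an edge of \<open>E\<close>.
  Empty pieces are excluded because each piece is to become a path with at least one vertex.\<close>

lemma path_edges_split_runs:
  "E \<subseteq> path_edges vs \<Longrightarrow> \<exists>vss. concat vss = vs \<and> [] \<notin> set vss \<and> E = (\<Union>ws\<in>set vss. path_edges ws)"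
proof (induction vs arbitrary: E rule: path_edges.induct)
  case (1 a b vs)
  have "E \<inter> path_edges (b # vs) \<subseteq> path_edges (b # vs)" by blast
  from "1.IH"[OF this] obtain vss where vss: "concat vss = b # vs" "[] \<notin> set vss"
    "E \<inter> path_edges (b # vs) = (\<Union>ws\<in>set vss. path_edges ws)" by blast
  show ?case
  proof (cases "{a, b} \<in> E")
    case True
    obtain ws wss where w: "vss = (b # ws) # wss"
      using vss(1,2) by (cases vss; cases "hd vss") auto
    have "E = insert {a, b} (E \<inter> path_edges (b # vs))" using True "1.prems" by auto
    then have "E = (\<Union>ws\<in>set ((a # b # ws) # wss). path_edges ws)" unfolding vss(3) w by auto
    then show ?thesis using vss w by (intro exI[of _ "(a # b # ws) # wss"]) auto
  next
    case False
    then have "E = E \<inter> path_edges (b # vs)" using "1.prems" by auto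
    then show ?thesis using vss by (intro exI[of _ "[a] # vss"]) auto
  qed
next
  case "2_1"
  then show ?case by (intro exI[of _ "[]"]) auto
next
  case ("2_2" v)
  then show ?case by (intro exI[of _ "[[v]]"]) auto
qed

text \<open>The map goes backwards, from \<open>H\<close> to \<open>G\<close>: reading off the
  vertex at a given position is explicit, whereas its inverse is not.\<close>

lemma isomorphicI:
  assumes g: "bij_betw g (verts H) (verts G)" and "edges G = (\<lambda>e. g ` e) ` edges H"
    and "\<And>e. e \<in> edges H \<Longrightarrow> e \<subseteq> verts H"
  shows "isomorphic G H"
proof -
  have "inv_into (verts H) g ` g ` e = e" if "e \<in> edges H" for e
    using g assms(3)[OF that] by (simp add: bij_betw_def inv_into_image_cancel)
  then have "edges H = (\<lambda>e. inv_into (verts H) g ` e) ` edges G"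
    unfolding assms(2) by (force simp: image_image)
  then show ?thesis using bij_betw_inv_into[OF g] by (auto simp: isomorphic_def)
qed

lemma union_of_pathsI:
  assumes d: "distinct vs" and V: "verts H = set vs" and E: "edges H \<subseteq> path_edges vs"
  shows "union_of_paths H"
proof -
  obtain vss where vss: "concat vss = vs" "[] \<notin> set vss" "edges H = (\<Union>ws\<in>set vss. path_edges ws)"
    using path_edges_split_runs[OF E] by blast
  let ?m = "length vss" and ?k = "\<lambda>i. length (vss ! i)"
  let ?D = "disj_Union ?m (\<lambda>i. path_graph (?k i))"
  define g where "g = (\<lambda>(i, j). vss ! i ! j)"
  have dc: "distinct vss" "\<And>ws. ws \<in> set vss \<Longrightarrow> distinct ws"
    "\<And>ws us. ws \<in> set vss \<Longrightarrow> us \<in> set vss \<Longrightarrow> ws \<noteq> us \<Longrightarrow> set ws \<inter> set us = {}"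
    using d vss(2) unfolding vss(1)[symmetric] distinct_concat_iff by (auto simp: removeAll_id)
  have sv: "set vss = (!) vss ` {..<?m}" by (auto simp: in_set_conv_nth)
  have "inj_on g (verts ?D)"
  proof (rule inj_onI)
    fix x y assume xy: "x \<in> verts ?D" "y \<in> verts ?D" "g x = g y"
    obtain i j i' j' where x: "x = (i, j)" and y: "y = (i', j')" by (metis surj_pair)
    have b: "i < ?m" "j < ?k i" "i' < ?m" "j' < ?k i'"
      using xy by (auto simp: x y disj_Union_def path_graph_def)
    have eq: "vss ! i ! j = vss ! i' ! j'" using xy(3) by (simp add: x y g_def)
    then have "vss ! i = vss ! i'" using dc(3)[of "vss ! i" "vss ! i'"] b nth_mem by (metis IntI empty_iff)
    then have "i = i'" using dc(1) b by (simp add: nth_eq_iff_index_eq)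
    moreover have "j = j'" using eq b dc(2)[of "vss ! i"] \<open>i = i'\<close> by (simp add: nth_eq_iff_index_eq)
    ultimately show "x = y" by (simp add: x y)
  qed
  moreover have "g ` verts ?D = verts H"
  proof -
    have "g ` verts ?D = (\<Union>i<?m. (!) (vss ! i) ` {..<?k i})"
      by (auto simp: disj_Union_def path_graph_def g_def)
    also have "\<dots> = (\<Union>i<?m. set (vss ! i))"
      by (intro SUP_cong refl) (auto simp: in_set_conv_nth)
    also have "\<dots> = verts H" unfolding V vss(1)[symmetric] by (simp add: sv)
    finally show ?thesis .
  qed
  ultimately have bij: "bij_betw g (verts ?D) (verts H)" by (simp add: bij_betw_def)
  have "(\<lambda>e. g ` e) ` edges ?D = (\<Union>i<?m. (\<lambda>e. g ` Pair i ` e) ` {{j, Suc j} |j. Suc j < ?k i})"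
    by (simp add: disj_Union_def path_graph_def image_UN image_image)
  also have "\<dots> = (\<Union>i<?m. path_edges (vss ! i))"
    by (simp add: path_edges_nth g_def setcompr_eq_image image_image)
  also have "\<dots> = edges H" unfolding vss(3) by (simp add: sv)
  finally have "edges H = (\<lambda>e. g ` e) ` edges ?D" by simp
  moreover have "e \<subseteq> verts ?D" if "e \<in> edges ?D" for e
    using that by (auto simp: disj_Union_def path_graph_def)
  ultimately have "isomorphic H ?D" using bij by (intro isomorphicI)
  moreover have "\<forall>i<?m. 1 \<le> ?k i" using vss(2) by (metis One_nat_def Suc_leI length_greater_0_conv nth_mem)
  ultimately show ?thesis unfolding union_of_paths_def
    by (intro exI[of _ ?m] exI[of _ ?k] conjI)
qed

section \<open>Rayleigh quotients\<close>

lemma vertex_list: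
  assumes "finite (verts G)"
  shows "distinct (vertex_list G)" "set (vertex_list G) = verts G" "length (vertex_list G) = card (verts G)"
    "bij_betw ((!) (vertex_list G)) {..<card (verts G)} (verts G)"
proof -
  have "\<exists>vs. distinct vs \<and> set vs = verts G" using finite_distinct_list[OF assms] by blast
  then have *: "distinct (vertex_list G) \<and> set (vertex_list G) = verts G"
    unfolding vertex_list_def by (rule someI_ex)
  then show "distinct (vertex_list G)" "set (vertex_list G) = verts G" by auto
  then show l: "length (vertex_list G) = card (verts G)" using distinct_card by metis
  show "bij_betw ((!) (vertex_list G)) {..<card (verts G)} (verts G)"
    using bij_betw_nth[of "vertex_list G"] * l by simp
qed

lemma vertex_index:
  assumes "finite (verts G)" "v \<in> verts G"
  obtains i where "i < card (verts G)" "vertex_list G ! i = v"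
  using assms vertex_list(2,3)[OF assms(1)] by (metis in_set_conv_nth)

lemma adj_matrix_carrier: "adj_matrix G \<in> carrier_mat (card (verts G)) (card (verts G))"
  by (simp add: adj_matrix_def)

lemma vertex_vector_carrier: "vertex_vector G x \<in> carrier_vec (card (verts G))"
  by (simp add: vertex_vector_def)

lemma mat_vec_index:
  assumes "A \<in> carrier_mat n m" "i < n"
  shows "vec_index (A *\<^sub>v Matrix.vec m f) i = (\<Sum>j = 0..<m. A $$ (i, j) * f j)"
  using assms by (simp add: scalar_prod_def)

text \<open>The adjacency operator on functions, free of any enumeration of the vertices. It is
  polymorphic because quadratic forms are real while the spectral radius belongs to the complex
  matrix.\<close>

definition nbr_sum :: "'a ugraph \<Rightarrow> ('a \<Rightarrow> 'b::comm_ring_1) \<Rightarrow> 'a \<Rightarrow> 'b" where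
  "nbr_sum G x v = (\<Sum>w\<in>nbrs G v. x w)"

lemma nbr_sum_if:
  assumes "simple_graph G"
  shows "nbr_sum G x v = (\<Sum>w\<in>verts G. if w \<in> nbrs G v then x w else 0)"
proof -
  have "finite (verts G)" using assms by (simp add: simple_graph_def)
  moreover have "verts G \<inter> nbrs G v = nbrs G v" using nbrs_subset[OF assms] by blast
  ultimately show ?thesis unfolding nbr_sum_def by (simp add: sum.inter_restrict[symmetric])
qed

lemma adj_matrix_mult_vertex_vector:
  assumes "simple_graph G"
  shows "adj_matrix G *\<^sub>v vertex_vector G x = vertex_vector G (nbr_sum G x)"
proof (rule eq_vecI)
  note V = vertex_list[of G]
  have fin: "finite (verts G)" using assms by (simp add: simple_graph_def)
  fix i assume "i < dim_vec (vertex_vector G (nbr_sum G x))"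
  then have i: "i < card (verts G)" by (simp add: vertex_vector_def)
  let ?l = "vertex_list G"
  have "vec_index (adj_matrix G *\<^sub>v vertex_vector G x) i =
      (\<Sum>j = 0..<card (verts G). (if {?l ! i, ?l ! j} \<in> edges G then 1 else 0) * x (?l ! j))"
    using i by (simp add: adj_matrix_def vertex_vector_def scalar_prod_def)
  also have "\<dots> = (\<Sum>j<card (verts G). if ?l ! j \<in> nbrs G (?l ! i) then x (?l ! j) else 0)"
    by (rule sum.cong) (auto simp: nbrs_def)
  also have "\<dots> = (\<Sum>w\<in>verts G. if w \<in> nbrs G (?l ! i) then x w else 0)"
    by (rule sum.reindex_bij_betw[OF V(4)[OF fin]])
  also have "\<dots> = nbr_sum G x (?l ! i)" by (rule nbr_sum_if[OF assms, symmetric])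
  finally show "vec_index (adj_matrix G *\<^sub>v vertex_vector G x) i = vec_index (vertex_vector G (nbr_sum G x)) i"
    using i by (simp add: vertex_vector_def)
qed (simp add: adj_matrix_def vertex_vector_def)

lemma eigenvector_nbr_sum:
  assumes "simple_graph G" "eigenvector (adj_matrix G) (vertex_vector G x) r" "v \<in> verts G"
  shows "nbr_sum G x v = r * x v"
proof -
  have fin: "finite (verts G)" using assms by (simp add: simple_graph_def)
  obtain i where i: "i < card (verts G)" "vertex_list G ! i = v"
    using vertex_index[OF fin assms(3)] .
  have "vertex_vector G (nbr_sum G x) = r \<cdot>\<^sub>v vertex_vector G x"
    using assms(2) adj_matrix_mult_vertex_vector[OF assms(1), of x] by (simp add: eigenvector_def)
  then have "vec_index (vertex_vector G (nbr_sum G x)) i = vec_index (r \<cdot>\<^sub>v vertex_vector G x) i" by simp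
  then show ?thesis using i by (simp add: vertex_vector_def)
qed

lemma nbr_sum_symmetric:
  assumes "simple_graph G"
  shows "(\<Sum>v\<in>verts G. nbr_sum G x v * y v) = (\<Sum>v\<in>verts G. x v * nbr_sum G y v)"
proof -
  have "(\<Sum>v\<in>verts G. nbr_sum G x v * y v) =
      (\<Sum>v\<in>verts G. \<Sum>w\<in>verts G. if w \<in> nbrs G v then x w * y v else 0)"
    unfolding nbr_sum_if[OF assms] sum_distrib_right by (intro sum.cong refl) auto
  also have "\<dots> = (\<Sum>w\<in>verts G. \<Sum>v\<in>verts G. if w \<in> nbrs G v then x w * y v else 0)"
    by (rule sum.swap)
  also have "\<dots> = (\<Sum>w\<in>verts G. x w * nbr_sum G y w)"
    unfolding nbr_sum_if[OF assms] sum_distrib_left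
    using nbrs_facts(4)[OF assms] by (intro sum.cong refl) auto
  finally show ?thesis .
qed

lemma funpow_nbr_sum_symmetric:
  assumes "simple_graph G"
  shows "(\<Sum>v\<in>verts G. (nbr_sum G ^^ j) x v * y v) = (\<Sum>v\<in>verts G. x v * (nbr_sum G ^^ j) y v)"
proof (induction j arbitrary: y)
  case (Suc j)
  have "(\<Sum>v\<in>verts G. (nbr_sum G ^^ Suc j) x v * y v) = (\<Sum>v\<in>verts G. (nbr_sum G ^^ j) x v * nbr_sum G y v)"
    using nbr_sum_symmetric[OF assms] by simp
  also have "\<dots> = (\<Sum>v\<in>verts G. x v * (nbr_sum G ^^ j) (nbr_sum G y) v)" by (rule Suc.IH)
  finally show ?case by (simp add: funpow_swap1)
qed simp

lemma of_real_nbr_sum: "of_real (nbr_sum G y v) = nbr_sum G (\<lambda>v. of_real (y v)) v"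
  by (simp add: nbr_sum_def)

lemma pow_adj_matrix_mult_vertex_vector:
  assumes "simple_graph G"
  shows "adj_matrix G ^\<^sub>m k *\<^sub>v vertex_vector G x = vertex_vector G ((nbr_sum G ^^ k) x)"
proof (induction k arbitrary: x)
  case 0
  show ?case using vertex_vector_carrier[of G x] by (simp add: adj_matrix_def)
next
  case (Suc k)
  let ?A = "adj_matrix G :: 'b mat"
  have "?A ^\<^sub>m Suc k *\<^sub>v vertex_vector G x = ?A ^\<^sub>m k *\<^sub>v (?A *\<^sub>v vertex_vector G x)"
    using assoc_mult_mat_vec[OF pow_carrier_mat[OF adj_matrix_carrier] adj_matrix_carrier vertex_vector_carrier]
    by simp
  then show ?case
    by (simp add: adj_matrix_mult_vertex_vector[OF assms] Suc.IH funpow_swap1)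
qed

lemma smult_pow_mat:
  fixes A :: "'a::comm_ring_1 mat"
  assumes A: "A \<in> carrier_mat n n"
  shows "(c \<cdot>\<^sub>m A) ^\<^sub>m k = c ^ k \<cdot>\<^sub>m (A ^\<^sub>m k)"
proof (induction k)
  case 0
  show ?case using A by (intro eq_matI) auto
next
  case (Suc k)
  have "(c \<cdot>\<^sub>m A) ^\<^sub>m Suc k = (c ^ k \<cdot>\<^sub>m (A ^\<^sub>m k)) * (c \<cdot>\<^sub>m A)" by (simp add: Suc)
  also have "\<dots> = c ^ k \<cdot>\<^sub>m (c \<cdot>\<^sub>m (A ^\<^sub>m k * A))"
    using mult_smult_assoc_mat[OF pow_carrier_mat[OF A] smult_carrier_mat[OF A]]
      mult_smult_distrib[OF pow_carrier_mat[OF A] A] by metis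
  also have "\<dots> = c ^ Suc k \<cdot>\<^sub>m (A ^\<^sub>m Suc k)"
    using A by (intro eq_matI) (auto simp: mult_ac)
  finally show ?case .
qed

text \<open>Dividing by \<open>r\<close> brings the spectral radius strictly below 1, where the
  decay of the Jordan blocks beats their polynomial factors and all powers stay bounded.\<close>

lemma spectral_radius_power_growth:
  assumes A: "A \<in> carrier_mat n n" and n: "0 < n" and r: "spectral_radius A < r"
  obtains c where "\<And>k i j. i < n \<Longrightarrow> j < n \<Longrightarrow> norm ((A ^\<^sub>m k) $$ (i, j)) \<le> c * r ^ k"
proof -
  have "0 \<le> spectral_radius A" using spectral_radius_mem_max(1)[OF A n] by auto
  then have r0: "0 < r" using r by simp
  let ?c = "of_real (inverse r) :: complex"
  let ?B = "?c \<cdot>\<^sub>m A"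
  have B: "?B \<in> carrier_mat n n" using A by simp
  have "spectral_radius ?B < 1"
  proof -
    obtain ev where ev: "ev \<in> spectrum ?B" "spectral_radius ?B = norm ev"
      using spectral_radius_mem_max(1)[OF B n] by blast
    then obtain v where v: "v \<in> carrier_vec n" "v \<noteq> 0\<^sub>v n" "?B *\<^sub>v v = ev \<cdot>\<^sub>v v"
      using A by (auto simp: spectrum_def eigenvalue_def eigenvector_def)
    have "A *\<^sub>v v = (of_real r * ev) \<cdot>\<^sub>v v"
    proof -
      have "A *\<^sub>v v = of_real r \<cdot>\<^sub>v (?c \<cdot>\<^sub>v (A *\<^sub>v v))"
        using r0 A by (intro eq_vecI) auto
      also have "?c \<cdot>\<^sub>v (A *\<^sub>v v) = ?B *\<^sub>v v" using A v(1) by (intro eq_vecI) auto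
      finally show ?thesis using v by (simp add: smult_smult_assoc)
    qed
    then have "of_real r * ev \<in> spectrum A"
      using v A by (auto simp: spectrum_def eigenvalue_def eigenvector_def)
    then have "norm (of_real r * ev) \<le> spectral_radius A"
      by (intro spectral_radius_mem_max(2)[OF A n]) auto
    then have "r * norm ev \<le> spectral_radius A" using r0 by (simp add: norm_mult)
    with r have "r * norm ev < r" by linarith
    then show ?thesis using r0 ev by simp
  qed
  then obtain c where c: "\<And>k. norm_bound (?B ^\<^sub>m k) c"
    using spectral_radius_jnf_norm_bound_less_1_upper_triangular[OF B] by blast
  have "norm ((A ^\<^sub>m k) $$ (i, j)) \<le> c * r ^ k" if ij: "i < n" "j < n" for k i j
  proof -
    have Ak: "A ^\<^sub>m k \<in> carrier_mat n n" by (rule pow_carrier_mat[OF A])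
    then have X: "?c ^ k \<cdot>\<^sub>m (A ^\<^sub>m k) \<in> carrier_mat n n" by simp
    have "norm ((?c ^ k \<cdot>\<^sub>m (A ^\<^sub>m k)) $$ (i, j)) \<le> c"
      using c[of k] ij unfolding smult_pow_mat[OF A] norm_bound_def carrier_matD[OF X] by blast
    then have "inverse r ^ k * norm ((A ^\<^sub>m k) $$ (i, j)) \<le> c"
      using r0 index_smult_mat(1)[of i "A ^\<^sub>m k" j "?c ^ k", unfolded carrier_matD[OF Ak], OF ij]
      by (simp add: norm_mult norm_power norm_inverse)
    then show ?thesis using r0 by (simp add: field_simps power_inverse)
  qed
  then show ?thesis using that by blast
qed

lemma nbr_sum_power_growth:
  fixes y :: "'a \<Rightarrow> real"
  assumes G: "simple_graph G" "verts G \<noteq> {}" and r: "graph_spectral_radius G < r"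
  obtains C where "\<And>k. (\<Sum>v\<in>verts G. y v * (nbr_sum G ^^ k) y v) \<le> C * r ^ k"
proof -
  have fin: "finite (verts G)" using G by (simp add: simple_graph_def)
  then have n: "0 < card (verts G)" using G(2) by (simp add: card_gt_0_iff)
  let ?n = "card (verts G)" and ?l = "vertex_list G"
  obtain c where c: "\<And>k i j. i < ?n \<Longrightarrow> j < ?n \<Longrightarrow> norm (((adj_matrix G :: complex mat) ^\<^sub>m k) $$ (i, j)) \<le> c * r ^ k"
    using spectral_radius_power_growth[OF adj_matrix_carrier n r[unfolded graph_spectral_radius_def]] by blast
  define M where "M = (\<Sum>v\<in>verts G. \<bar>y v\<bar>)"
  have bound: "\<bar>(nbr_sum G ^^ k) y v\<bar> \<le> c * r ^ k * M" if v: "v \<in> verts G" for k v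
  proof -
    obtain i where i: "i < ?n" "?l ! i = v"
      using vertex_index[OF fin v] .
    let ?A = "adj_matrix G :: complex mat"
    have Ak: "?A ^\<^sub>m k \<in> carrier_mat ?n ?n" by (rule pow_carrier_mat[OF adj_matrix_carrier])
    \<comment> \<open>The complex matrix preserves real vectors and acts on them by the real
      operator, so its entry bounds transfer.\<close>
    have real: "(nbr_sum G ^^ k) (\<lambda>v. complex_of_real (y v)) = (\<lambda>v. complex_of_real ((nbr_sum G ^^ k) y v))"
      by (induction k) (auto simp: of_real_nbr_sum)
    have "complex_of_real ((nbr_sum G ^^ k) y v) = vec_index (?A ^\<^sub>m k *\<^sub>v vertex_vector G (\<lambda>v. of_real (y v))) i"
      unfolding pow_adj_matrix_mult_vertex_vector[OF G(1)] real using i by (simp add: vertex_vector_def)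
    also have "\<dots> = (\<Sum>j = 0..<?n. (?A ^\<^sub>m k) $$ (i, j) * of_real (y (?l ! j)))"
      unfolding vertex_vector_def by (rule mat_vec_index[OF Ak i(1)])
    finally have "\<bar>(nbr_sum G ^^ k) y v\<bar> = norm (\<Sum>j = 0..<?n. (?A ^\<^sub>m k) $$ (i, j) * of_real (y (?l ! j)))"
      by (metis norm_of_real)
    also have "\<dots> \<le> (\<Sum>j = 0..<?n. c * r ^ k * \<bar>y (?l ! j)\<bar>)"
      using c i by (intro sum_norm_le) (auto simp: norm_mult intro!: mult_right_mono)
    also have "\<dots> = c * r ^ k * (\<Sum>j<?n. \<bar>y (?l ! j)\<bar>)"
      by (simp add: sum_distrib_left atLeast0LessThan)
    also have "(\<Sum>j<?n. \<bar>y (?l ! j)\<bar>) = M"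
      unfolding M_def by (rule sum.reindex_bij_betw[OF vertex_list(4)[OF fin]])
    finally show ?thesis .
  qed
  have "(\<Sum>v\<in>verts G. y v * (nbr_sum G ^^ k) y v) \<le> (M * c * M) * r ^ k" for k
  proof -
    have "(\<Sum>v\<in>verts G. y v * (nbr_sum G ^^ k) y v) \<le> (\<Sum>v\<in>verts G. \<bar>y v\<bar> * (c * r ^ k * M))"
    proof (rule sum_mono)
      fix v assume v: "v \<in> verts G"
      have "y v * (nbr_sum G ^^ k) y v \<le> \<bar>y v\<bar> * \<bar>(nbr_sum G ^^ k) y v\<bar>"
        by (metis abs_ge_self abs_mult)
      also have "\<dots> \<le> \<bar>y v\<bar> * (c * r ^ k * M)" using bound[OF v] by (intro mult_left_mono) auto
      finally show "y v * (nbr_sum G ^^ k) y v \<le> \<bar>y v\<bar> * (c * r ^ k * M)" .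
    qed
    also have "\<dots> = M * (c * r ^ k * M)" by (simp only: M_def sum_distrib_right)
    finally show ?thesis by (simp add: mult_ac)
  qed
  then show ?thesis using that by blast
qed

text \<open>By Cauchy--Schwarz the moments \<open>\<langle>y, A\<^sup>m y\<rangle>\<close> with \<open>m = 2\<^sup>k\<close> grow at least like the \<open>m\<close>-th power
  of the Rayleigh quotient, whereas powers of \<open>A\<close> cannot outgrow the spectral radius.\<close>

lemma rayleigh_le_graph_spectral_radius:
  fixes y :: "'a \<Rightarrow> real"
  assumes G: "simple_graph G"
  shows "(\<Sum>v\<in>verts G. y v * nbr_sum G y v) \<le> graph_spectral_radius G * (\<Sum>v\<in>verts G. (y v)\<^sup>2)"
proof (cases "(\<Sum>v\<in>verts G. (y v)\<^sup>2) = 0")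
  case True
  have fin: "finite (verts G)" using G by (simp add: simple_graph_def)
  then have "\<forall>v\<in>verts G. y v = 0" using True by (simp add: sum_nonneg_eq_0_iff)
  then show ?thesis by simp
next
  case False
  define N where "N = (\<Sum>v\<in>verts G. (y v)\<^sup>2)"
  have N: "0 < N" using False sum_nonneg[of "verts G" "\<lambda>v. (y v)\<^sup>2"] unfolding N_def by force
  have ne: "verts G \<noteq> {}" using False by auto
  define a where "a k = (\<Sum>v\<in>verts G. y v * (nbr_sum G ^^ k) y v)" for k
  have rho0: "0 \<le> graph_spectral_radius G"
  proof -
    have "0 < card (verts G)" using G ne by (simp add: card_gt_0_iff simple_graph_def)
    from spectral_radius_mem_max(1)[OF adj_matrix_carrier this] show ?thesis
      unfolding graph_spectral_radius_def by auto
  qed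
  show ?thesis
  proof (rule ccontr)
    assume "\<not> ?thesis"
    then have lt: "graph_spectral_radius G * N < a 1" by (simp add: a_def N_def)
    define l where "l = a 1 / N"
    have l: "graph_spectral_radius G < l" using lt N by (simp add: l_def field_simps)
    have l0: "0 < l" using l rho0 by simp
    \<comment> \<open>Moving half of the \<open>2 * k\<close> applications to the other factor by
      symmetry makes \<open>a (2 * k)\<close> a squared norm.\<close>
    have double: "(a k)\<^sup>2 \<le> N * a (2 * k)" for k
    proof -
      have "a (2 * k) = (\<Sum>v\<in>verts G. ((nbr_sum G ^^ k) y v)\<^sup>2)"
        using funpow_nbr_sum_symmetric[OF G, of k y "(nbr_sum G ^^ k) y"]
        by (simp add: a_def mult_2 funpow_add power2_eq_square)
      then show ?thesis unfolding a_def N_def by (metis Cauchy_Schwarz_ineq_sum)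
    qed
    have grow: "l ^ (2 ^ k) * N \<le> a (2 ^ k)" for k
    proof (induction k)
      case 0 then show ?case using N by (simp add: l_def)
    next
      case (Suc k)
      have "(l ^ (2 ^ k) * N)\<^sup>2 \<le> (a (2 ^ k))\<^sup>2" using Suc l0 N by (intro power_mono) auto
      also have "\<dots> \<le> N * a (2 ^ Suc k)" using double[of "2 ^ k"] by simp
      finally have "N * (l ^ (2 ^ Suc k) * N) \<le> N * a (2 ^ Suc k)"
        by (simp add: power_mult_distrib power2_eq_square power_add[symmetric] mult_2 mult_ac)
      then show ?case using N by simp
    qed
    \<comment> \<open>The base must exceed the spectral radius for the growth bound and stay below
      \<open>l\<close> for the contradiction; the midpoint does both.\<close>
    define r where "r = (l + graph_spectral_radius G) / 2"
    have r: "graph_spectral_radius G < r" "r < l" "0 < r" using l rho0 by (auto simp: r_def)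
    obtain C where C: "\<And>k. a k \<le> C * r ^ k"
      unfolding a_def using nbr_sum_power_growth[OF G ne r(1), of y] by blast
    have q: "1 < l / r" using r by simp
    obtain k where k: "C / N < (l / r) ^ k" using real_arch_pow[OF q] by blast
    also have "\<dots> \<le> (l / r) ^ (2 ^ k)" using q by (intro power_increasing) auto
    finally have "C * r ^ (2 ^ k) < l ^ (2 ^ k) * N" using N r by (simp add: power_divide field_simps)
    then show False using grow[of k] C[of "2 ^ k"] by linarith
  qed
qed

section \<open>Fans\<close>

lemma contained_inI:
  assumes F: "simple_graph F" and g: "inj_on g (verts F)" "g ` verts F \<subseteq> verts G"
    and e: "\<And>e. e \<in> edges F \<Longrightarrow> g ` e \<in> edges G"
  shows "contained_in F G"
proof -
  let ?H = "\<lparr>verts = g ` verts F, edges = (\<lambda>e. g ` e) ` edges F\<rparr>"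
  have "card (g ` e) = 2" if "e \<in> edges F" for e
    using F that card_image[OF inj_on_subset[OF g(1)], of e] by (simp add: simple_graph_def)
  then have "simple_graph ?H" using F by (auto simp: simple_graph_def)
  then have "subgraph ?H G" using g e by (auto simp: subgraph_def)
  moreover have "isomorphic F ?H" using g by (auto simp: isomorphic_def bij_betw_def)
  ultimately show ?thesis unfolding contained_in_def by blast
qed

lemma contained_inE:
  assumes "contained_in F G"
  obtains g where "inj_on g (verts F)" "g ` verts F \<subseteq> verts G" "\<And>e. e \<in> edges F \<Longrightarrow> g ` e \<in> edges G"
proof -
  obtain H where H: "subgraph H G" "isomorphic F H" using assms by (auto simp: contained_in_def)
  then obtain g where g: "bij_betw g (verts F) (verts H)" "edges H = (\<lambda>e. g ` e) ` edges F"
    by (auto simp: isomorphic_def)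
  show ?thesis by (rule that[of g]) (use H(1) g in \<open>auto simp: bij_betw_def subgraph_def\<close>)
qed

lemma contained_in_embed:
  assumes F: "simple_graph F" "contained_in F H"
    and h: "inj_on h (verts H)" "h ` verts H \<subseteq> verts G" "\<And>e. e \<in> edges H \<Longrightarrow> h ` e \<in> edges G"
  shows "contained_in F G"
proof -
  obtain g where g: "inj_on g (verts F)" "g ` verts F \<subseteq> verts H" "\<And>e. e \<in> edges F \<Longrightarrow> g ` e \<in> edges H"
    using contained_inE[OF F(2)] by blast
  show ?thesis
  proof (rule contained_inI[OF F(1), of "h \<circ> g"])
    show "inj_on (h \<circ> g) (verts F)" using g(1,2) h(1) by (meson comp_inj_on inj_on_subset)
    show "(h \<circ> g) ` verts F \<subseteq> verts G" using g(2) h(2) by auto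
    show "(h \<circ> g) ` e \<in> edges G" if "e \<in> edges F" for e
      using h(3)[OF g(3)[OF that]] by (simp add: image_comp)
  qed
qed

text \<open>The hub is 0, and \<open>I\<close> selects which consecutive rim vertices are joined. So
  \<open>fan n {}\<close> is the star, and a hub joined to any union of paths is another choice of
  \<open>I\<close>. The vertex set is the one that \<open>spex_OP\<close> prescribes.\<close>

definition fan :: "nat \<Rightarrow> nat set \<Rightarrow> nat ugraph" where
  "fan n I = \<lparr>verts = {..<n},
     edges = {{0, i} |i. 0 < i \<and> i < n} \<union> {{i, Suc i} |i. i \<in> I \<and> 0 < i \<and> Suc i < n}\<rparr>"

lemma verts_fan [simp]: "verts (fan n I) = {..<n}"
  by (simp add: fan_def)

lemma simple_graph_fan: "simple_graph (fan n I)"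
  by (auto simp: simple_graph_def fan_def card_insert_if)

lemma fan_edge_cases:
  assumes "e \<in> edges (fan n I)"
  obtains (spoke) i where "e = {0, i}" "0 < i" "i < n"
    | (rim) i where "e = {i, Suc i}" "i \<in> I" "0 < i" "Suc i < n"
  using assms by (auto simp: fan_def)

text \<open>Hub on the real axis, rim on the line of height 1: the drawing fits between these two
  lines, and every vertex lies on one of them.\<close>

definition fan_point :: "nat \<Rightarrow> complex" where
  "fan_point i = (if i = 0 then 0 else Complex (real i) 1)"

text \<open>Edges are unordered; \<open>Min\<close> and \<open>Max\<close> merely choose a direction
  for the segment.\<close>

definition fan_edge :: "nat set \<Rightarrow> real \<Rightarrow> complex" where
  "fan_edge e = linepath (fan_point (Min e)) (fan_point (Max e))"

lemma fan_spoke_points: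
  assumes "0 < i" "z \<in> path_image (fan_edge {0, i})"
  shows "0 \<le> Im z \<and> Im z \<le> 1 \<and> Re z = real i * Im z"
  using assms by (auto simp: fan_edge_def fan_point_def in_segment)

lemma fan_rim_points:
  assumes "0 < i" "z \<in> path_image (fan_edge {i, Suc i})"
  shows "Im z = 1 \<and> real i \<le> Re z \<and> Re z \<le> real i + 1"
proof -
  obtain u where u: "0 \<le> u" "u \<le> 1" "z = (1 - u) *\<^sub>R Complex (real i) 1 + u *\<^sub>R Complex (real i + 1) 1"
    using assms by (auto simp: fan_edge_def fan_point_def in_segment add.commute)
  have "Re z = real i + u" "Im z = 1" unfolding u(3) by (simp_all add: algebra_simps)
  then show ?thesis using u by simp
qed

lemma inj_fan_point: "inj fan_point"
  by (auto simp: inj_def fan_point_def complex_eq_iff split: if_splits)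

lemma fan_point_eq: "0 < i \<Longrightarrow> Im z = 1 \<Longrightarrow> Re z = real i \<Longrightarrow> z = fan_point i"
  by (simp add: fan_point_def complex_eq_iff)

lemma fan_spoke_spoke:
  assumes "0 < i" "0 < j" "i \<noteq> j" "z \<in> path_image (fan_edge {0, i})" "z \<in> path_image (fan_edge {0, j})"
  shows "z \<in> fan_point ` ({0, i} \<inter> {0, j})"
proof -
  have "real i * Im z = real j * Im z" using fan_spoke_points assms by metis
  then have "Im z = 0" using assms(3) by simp
  then have "z = fan_point 0" using fan_spoke_points[OF assms(1,4)] by (simp add: fan_point_def complex_eq_iff)
  then show ?thesis by blast
qed

lemma fan_spoke_rim:
  assumes "0 < i" "0 < j" "z \<in> path_image (fan_edge {0, i})" "z \<in> path_image (fan_edge {j, Suc j})"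
  shows "z \<in> fan_point ` ({0, i} \<inter> {j, Suc j})"
proof -
  have z: "Im z = 1" "Re z = real i" "real j \<le> real i" "real i \<le> real j + 1"
    using fan_spoke_points[OF assms(1,3)] fan_rim_points[OF assms(2,4)] by auto
  then have "i = j \<or> i = Suc j" by linarith
  then show ?thesis using fan_point_eq[OF assms(1) z(1,2)] by auto
qed

lemma fan_rim_rim:
  assumes "0 < i" "i < j" "z \<in> path_image (fan_edge {i, Suc i})" "z \<in> path_image (fan_edge {j, Suc j})"
  shows "z \<in> fan_point ` ({i, Suc i} \<inter> {j, Suc j})"
proof -
  have z: "Im z = 1" "Re z \<le> real i + 1" "real j \<le> Re z"
    using fan_rim_points[OF assms(1,3)] fan_rim_points[of j z] assms by auto
  then have "j = Suc i" "Re z = real j" using assms(2) by linarith+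
  then show ?thesis using fan_point_eq[of j z] z(1) by auto
qed

lemma fan_drawing: "plane_drawing (fan n I) fan_point fan_edge"
  unfolding plane_drawing_def
proof (intro conjI ballI impI)
  show "inj_on fan_point (verts (fan n I))" using inj_fan_point by (rule inj_on_subset) simp
next
  fix e assume "e \<in> edges (fan n I)"
  then obtain a b where e: "e = {a, b}" "a < b" by (cases rule: fan_edge_cases) auto
  then have "fan_point a \<noteq> fan_point b" using inj_fan_point by (metis injD less_irrefl)
  then show "arc (fan_edge e)" using e by (simp add: fan_edge_def)
  show "{pathstart (fan_edge e), pathfinish (fan_edge e)} = fan_point ` e"
    using e by (simp add: fan_edge_def)
next
  fix e v assume e: "e \<in> edges (fan n I)" and v: "fan_point v \<in> path_image (fan_edge e)"
  show "v \<in> e"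
    using e
  proof (cases rule: fan_edge_cases)
    case (spoke i)
    then show ?thesis using v fan_spoke_points[of i "fan_point v"] by (auto simp: fan_point_def split: if_splits)
  next
    case (rim i)
    then have "Im (fan_point v) = 1" "real i \<le> Re (fan_point v)" "Re (fan_point v) \<le> real i + 1"
      using v fan_rim_points[of i "fan_point v"] by auto
    then have "v = i \<or> v = Suc i" by (cases "v = 0") (simp_all add: fan_point_def, linarith)
    then show ?thesis using rim by auto
  qed
next
  fix e f assume ef: "e \<in> edges (fan n I)" "f \<in> edges (fan n I)" "e \<noteq> f"
  show "path_image (fan_edge e) \<inter> path_image (fan_edge f) \<subseteq> fan_point ` (e \<inter> f)"
    using ef(1)
  proof (cases rule: fan_edge_cases)
    case e: (spoke i)
    from ef(2) show ?thesis
    proof (cases rule: fan_edge_cases)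
      case (spoke j)
      then show ?thesis using fan_spoke_spoke[of i j] e ef(3) by (metis IntE subsetI)
    next
      case (rim j)
      then show ?thesis using fan_spoke_rim[of i j] e by (metis IntE subsetI)
    qed
  next
    case e: (rim i)
    from ef(2) show ?thesis
    proof (cases rule: fan_edge_cases)
      case (spoke j)
      then show ?thesis using fan_spoke_rim[of j i] e by (metis IntE Int_commute subsetI)
    next
      case (rim j)
      then consider "i < j" | "j < i" using e ef(3) by (cases i j rule: linorder_cases) auto
      then show ?thesis
        using fan_rim_rim[of i j] fan_rim_rim[of j i] e rim by cases (metis IntE Int_commute subsetI)+
    qed
  qed
qed

lemma closure_vertical:
  assumes "s = 1 \<or> s = - 1" and "\<And>e. 0 < e \<Longrightarrow> Complex (Re z) (Im z + s * e) \<in> S"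
  shows "z \<in> closure S"
  unfolding closure_approachable
proof (intro allI impI)
  fix e :: real assume e: "0 < e"
  have "dist (Complex (Re z) (Im z + s * (e / 2))) z = e / 2"
    using assms(1) e by (auto simp: dist_norm cmod_def)
  then show "\<exists>y\<in>S. dist y z < e" using assms(2)[of "e / 2"] e by (metis field_sum_of_halves half_gt_zero less_add_same_cancel1)
qed

text \<open>The strip around the drawing is convex, so its complement belongs to the unbounded face.
  The hub is approached through it from below, the rim vertices from above.\<close>

lemma outerplanar_fan: "outerplanar (fan n I)"
proof -
  let ?K = "drawing_points (fan n I) fan_point fan_edge"
  let ?T = "{z. 0 \<le> Im z \<and> Im z \<le> 1}"
  have "path_image (fan_edge e) \<subseteq> ?T" if "e \<in> edges (fan n I)" for e
    using that
  proof (cases rule: fan_edge_cases)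
    case (spoke i) then show ?thesis using fan_spoke_points[of i] by blast
  next
    case (rim i) then show ?thesis using fan_rim_points[of i] by fastforce
  qed
  moreover have "fan_point v \<in> ?T" for v by (simp add: fan_point_def)
  ultimately have K: "?K \<subseteq> ?T" unfolding drawing_points_def by blast
  have "convex ?T"
    using convex_Int[OF convex_halfspace_Im_ge[of 0] convex_halfspace_Im_le[of 1]]
    by (simp add: Collect_conj_eq)
  then have out: "- ?T \<subseteq> outside ?K" using K by (rule outside_subset_convex)
  have "fan_point v \<in> frontier (outside ?K)" if v: "v \<in> verts (fan n I)" for v
  proof -
    have "fan_point v \<in> closure (- ?T)"
    proof (cases "v = 0")
      case True
      then show ?thesis by (intro closure_vertical[of "- 1"]) (auto simp: fan_point_def)
    next
      case False
      then show ?thesis by (intro closure_vertical[of 1]) (auto simp: fan_point_def)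
    qed
    then have "fan_point v \<in> closure (outside ?K)" using closure_mono[OF out] by blast
    moreover have "fan_point v \<in> ?K" using v by (simp add: drawing_points_def)
    then have "fan_point v \<notin> outside ?K" by (simp add: outside_def)
    then have "fan_point v \<notin> interior (outside ?K)" using interior_subset by blast
    ultimately show ?thesis by (simp add: frontier_def)
  qed
  then show ?thesis unfolding outerplanar_def using fan_drawing by blast
qed

text \<open>\<open>Max\<close> is an upper bound only on a finite set; here a competitor is
  determined by its set of edges on \<open>{..<n}\<close>.\<close>

lemma graph_spectral_radius_le_spex_OP:
  assumes "simple_graph H" "verts H = {..<n}" "outerplanar H" "\<not> contained_in F H"
  shows "graph_spectral_radius H \<le> spex_OP n F"
proof -
  let ?\<H> = "{H :: nat ugraph. simple_graph H \<and> verts H = {..<n} \<and> outerplanar H \<and> \<not> contained_in F H}"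
  have "?\<H> \<subseteq> (\<lambda>E. \<lparr>verts = {..<n}, edges = E\<rparr>) ` Pow (Pow {..<n})"
  proof
    fix H assume H: "H \<in> ?\<H>"
    then have "H = \<lparr>verts = {..<n}, edges = edges H\<rparr>" by simp
    moreover have "edges H \<in> Pow (Pow {..<n})" using H by (auto simp: simple_graph_def)
    ultimately show "H \<in> (\<lambda>E. \<lparr>verts = {..<n}, edges = E\<rparr>) ` Pow (Pow {..<n})" by blast
  qed
  then have "finite ?\<H>" by (rule finite_subset) auto
  then have "finite (graph_spectral_radius ` ?\<H>)" by simp
  then have "graph_spectral_radius H \<le> Max (graph_spectral_radius ` ?\<H>)"
    using assms by (intro Max_ge) auto
  then show ?thesis unfolding spex_OP_def by (simp add: setcompr_eq_image)
qed

lemma nbrs_fan_empty: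
  assumes "0 < i" "i < n"
  shows "nbrs (fan n {}) i = {0}"
  using assms by (auto simp: nbrs_def fan_def doubleton_eq_iff)

lemma nbrs_fan_0: "nbrs (fan n I) 0 = {1..<n}"
  by (auto simp: nbrs_def fan_def doubleton_eq_iff)

lemma star_spectral_radius:
  assumes "2 \<le> n"
  shows "sqrt (real n - 1) \<le> graph_spectral_radius (fan n {})"
proof -
  let ?G = "fan n {}" and ?s = "sqrt (real n - 1)"
  \<comment> \<open>The Perron vector of the star, whose eigenvalue is \<open>?s\<close>.\<close>
  define y where "y i = (if i = 0 then ?s else 1)" for i :: nat
  have s: "?s * ?s = real n - 1" using assms by simp
  have split: "(\<Sum>i<n. f i) = f 0 + (\<Sum>i = 1..<n. f i)" for f :: "nat \<Rightarrow> real"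
    using assms by (simp add: lessThan_atLeast0 sum.atLeast_Suc_lessThan)
  have "nbr_sum ?G y 0 = real n - 1"
    using assms by (simp add: nbr_sum_def nbrs_fan_0 y_def of_nat_diff)
  moreover have "nbr_sum ?G y i = ?s" if "i \<in> {1..<n}" for i
    using that by (simp add: nbr_sum_def nbrs_fan_empty y_def)
  ultimately have "(\<Sum>i<n. y i * nbr_sum ?G y i) = ?s * (2 * (real n - 1))"
    unfolding split using assms by (simp add: y_def of_nat_diff)
  moreover have "(\<Sum>i<n. (y i)\<^sup>2) = 2 * (real n - 1)"
    unfolding split using assms by (simp add: y_def of_nat_diff power2_eq_square)
  ultimately show ?thesis
    using rayleigh_le_graph_spectral_radius[OF simple_graph_fan, of y n "{}"] assms by simp
qed

text \<open>Any graph \<open>B\<close> on \<open>n - 1\<close> vertices serves for the leaves.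
  Applied to the join that \<open>F\<close> avoids, this shows that the star is
  \<open>F\<close>-free.\<close>

lemma star_contained_in_join:
  assumes F: "simple_graph F" "contained_in F (fan n {})"
    and B: "finite (verts B)" "card (verts B) = n - 1"
  shows "contained_in F (join_graph (complete_graph 1) B)"
proof -
  have "card {1..<n} = card (verts B)" using B(2) by simp
  then obtain h where h: "bij_betw h {1..<n} (verts B)"
    using finite_same_card_bij[of "{1..<n}" "verts B"] B(1) by auto
  let ?J = "join_graph (complete_graph 1) B"
  define g where "g i = (if i = 0 then Inl (0::nat) else Inr (h i))" for i :: nat
  have hB: "h i \<in> verts B" if "0 < i" "i < n" for i
    using bij_betwE[OF h] that by auto
  show ?thesis
  proof (rule contained_in_embed[OF F, where h = g])
    show "inj_on g (verts (fan n {}))"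
      using bij_betw_imp_inj_on[OF h] by (auto simp: inj_on_def g_def split: if_splits)
    show "g ` verts (fan n {}) \<subseteq> verts ?J"
      using hB by (auto simp: g_def join_graph_def disj_union_def complete_graph_def)
    show "g ` e \<in> edges ?J" if "e \<in> edges (fan n {})" for e
      using that
    proof (cases rule: fan_edge_cases)
      case (spoke i)
      then have "g ` e = {Inl 0, Inr (h i)}" by (auto simp: g_def)
      then show ?thesis using hB[of i] spoke by (auto simp: join_graph_def complete_graph_def)
    qed auto
  qed
qed

lemma card_verts_copies_complete:
  "finite (verts (copies m (complete_graph k)))" "card (verts (copies m (complete_graph k))) = m * k"
  by (simp_all add: copies_def disj_Union_def complete_graph_def)

text \<open>A copy of \<open>F\<close> uses at most \<open>d\<close> of the leaves \<open>1, \<dots>, n - 1\<close>, so the vertices beyond \<open>d\<close>, which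
  are adjacent to \<open>0\<close> only, can be exchanged for unused ones among \<open>1, \<dots>, d\<close>.\<close>

lemma fan_contained_in_smaller_fan:
  assumes F: "simple_graph F" "contained_in F (fan n I)"
    and d: "card (verts F) \<le> d" "I \<subseteq> {..<d}"
  shows "contained_in F (fan (Suc d) I)"
proof -
  obtain g where g: "inj_on g (verts F)" "g ` verts F \<subseteq> {..<n}"
    "\<And>e. e \<in> edges F \<Longrightarrow> g ` e \<in> edges (fan n I)"
    using contained_inE[OF F(2)] by auto
  have fin: "finite (verts F)" using F(1) by (simp add: simple_graph_def)
  define B where "B = {v \<in> verts F. d < g v}"
  define A where "A = {1..d} - g ` verts F"
  have "card {1..d} = card A + card ({1..d} \<inter> g ` verts F)"
  proof -
    have "{1..d} = A \<union> {1..d} \<inter> g ` verts F" by (auto simp: A_def)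
    moreover have "card (A \<union> {1..d} \<inter> g ` verts F) = card A + card ({1..d} \<inter> g ` verts F)"
      by (rule card_Un_disjoint) (auto simp: A_def)
    ultimately show ?thesis by simp
  qed
  moreover have "card ({1..d} \<inter> g ` verts F) + card B \<le> card (verts F)"
  proof -
    have "{1..d} \<inter> g ` verts F \<subseteq> g ` (verts F - B)" by (auto simp: B_def)
    then have "card ({1..d} \<inter> g ` verts F) \<le> card (verts F - B)"
      using fin by (meson card_image_le card_mono finite_Diff finite_imageI le_trans)
    moreover have "card (verts F - B) + card B = card (verts F)"
    proof -
      have "B \<subseteq> verts F" by (auto simp: B_def)
      then show ?thesis using fin card_mono[OF fin, of B] finite_subset[of B "verts F"]
        by (simp add: card_Diff_subset)
    qed
    ultimately show ?thesis by linarith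
  qed
  ultimately have "card B \<le> card A" using d(1) by simp
  moreover have "finite A" "finite B" using fin by (auto simp: A_def B_def)
  ultimately obtain h where h: "h ` B \<subseteq> A" "inj_on h B" by (meson card_le_inj)
  define k where "k v = (if v \<in> B then h v else g v)" for v
  have kB: "k v \<in> {1..d} - g ` verts F" if "v \<in> B" for v using h(1) that by (auto simp: k_def A_def)
  have kle: "k v = g v" "k v \<le> d" if "v \<in> verts F" "v \<notin> B" for v using that by (auto simp: k_def B_def)
  show ?thesis
  proof (rule contained_inI[OF F(1), of k])
    show "inj_on k (verts F)"
    proof (rule inj_onI)
      fix v w assume vw: "v \<in> verts F" "w \<in> verts F" "k v = k w"
      show "v = w"
      proof (cases "v \<in> B"; cases "w \<in> B")
        assume "v \<in> B" "w \<in> B"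
        then show ?thesis using vw(3) inj_onD[OF h(2)] by (simp add: k_def)
      next
        assume "v \<in> B" "w \<notin> B"
        then show ?thesis using vw kB[of v] kle(1)[of w] by auto
      next
        assume "v \<notin> B" "w \<in> B"
        then show ?thesis using vw kB[of w] kle(1)[of v] by (metis DiffD2 imageI)
      next
        assume "v \<notin> B" "w \<notin> B"
        then show ?thesis using vw inj_onD[OF g(1)] by (simp add: k_def)
      qed
    qed
    show "k ` verts F \<subseteq> verts (fan (Suc d) I)"
    proof
      fix z assume "z \<in> k ` verts F"
      then obtain v where "v \<in> verts F" "z = k v" by blast
      then show "z \<in> verts (fan (Suc d) I)" using kB[of v] kle(2)[of v] by (cases "v \<in> B") auto
    qed
    show "k ` e \<in> edges (fan (Suc d) I)" if e: "e \<in> edges F" for e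
    proof -
      obtain a b where ab: "e = {a, b}" "a \<in> verts F" "b \<in> verts F"
        using F(1) e by (auto simp: simple_graph_def card_2_iff)
      have spoke_edge: "{k a, k b} \<in> edges (fan (Suc d) I)"
        if "g a = 0" "0 < g b" "a \<in> verts F" "b \<in> verts F" for a b
      proof -
        have "a \<notin> B" using that by (simp add: B_def)
        then have "k a = 0" using that kle(1) by simp
        moreover have "0 < k b \<and> k b < Suc d" using that kB[of b] kle[of b] by (cases "b \<in> B") auto
        ultimately show ?thesis by (auto simp: fan_def)
      qed
      from g(3)[OF e] show ?thesis
      proof (cases rule: fan_edge_cases)
        case (spoke i)
        then have "g a = 0 \<and> 0 < g b \<or> g b = 0 \<and> 0 < g a" by (auto simp: ab doubleton_eq_iff)
        then show ?thesis using spoke_edge[of a b] spoke_edge[of b a] ab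
          by (auto simp: insert_commute)
      next
        case (rim i)
        \<comment> \<open>Rim edges end at positions up to \<open>d\<close>, so no displaced vertex,
          placed beyond \<open>d\<close>, is on one.\<close>
        then have "Suc i \<le> d" using d(2) by auto
        then have "a \<notin> B" "b \<notin> B" using rim by (auto simp: ab doubleton_eq_iff B_def)
        then have "k ` e = {i, Suc i}" using rim kle(1) ab by simp
        then show ?thesis using rim \<open>Suc i \<le> d\<close> by (auto simp: fan_def)
      qed
    qed
  qed
qed

section \<open>The extremal graph\<close>

text \<open>The extremality of \<open>G\<close> enters only through the two lower bounds on
  \<open>r\<close>, both obtained from the star; \<open>card_le\<close> is the star bound
  squared.\<close>

locale outerplanar_eigenvector =
  fixes G :: "'a ugraph" and x :: "'a \<Rightarrow> real" and r :: real and u :: 'a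
  assumes simple: "simple_graph G" and outer: "outerplanar G"
    and eigen: "v \<in> verts G \<Longrightarrow> nbr_sum G x v = r * x v"
    and pos: "v \<in> verts G \<Longrightarrow> 0 < x v" and le1: "v \<in> verts G \<Longrightarrow> x v \<le> 1"
    and u: "u \<in> verts G" "x u = 1"
    and r_large: "3563 \<le> r" and card_le: "real (card (verts G)) \<le> r\<^sup>2 + 1"
begin

definition W :: "'a set" where
  "W = verts G - nbrs G u - {u}"

lemma fin: "finite (verts G)" "finite (nbrs G v)" "finite W"
  using simple finite_nbrs[OF simple] by (auto simp: simple_graph_def W_def)

lemma u_notin_nbrs: "u \<notin> nbrs G u"
  using nbrs_facts(1)[OF simple] by blast

lemma W_subset: "W \<subseteq> verts G" "u \<notin> W" "W \<inter> nbrs G u = {}"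
  by (auto simp: W_def)

lemma nbr_sum_split:
  "nbr_sum G x v = (\<Sum>w\<in>nbrs G v \<inter> nbrs G u. x w) + (\<Sum>w\<in>nbrs G v \<inter> W. x w) +
     (if v \<in> nbrs G u then 1 else 0)"
proof -
  have un: "nbrs G v = (nbrs G v \<inter> nbrs G u) \<union> (nbrs G v \<inter> W) \<union> (nbrs G v \<inter> {u})"
    using nbrs_subset[OF simple, of v] by (auto simp: W_def)
  have "nbr_sum G x v = (\<Sum>w\<in>(nbrs G v \<inter> nbrs G u) \<union> (nbrs G v \<inter> W) \<union> (nbrs G v \<inter> {u}). x w)"
    unfolding nbr_sum_def using un by simp
  also have "\<dots> = (\<Sum>w\<in>nbrs G v \<inter> nbrs G u. x w) + (\<Sum>w\<in>nbrs G v \<inter> W. x w) + (\<Sum>w\<in>nbrs G v \<inter> {u}. x w)"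
    using u_notin_nbrs W_subset fin by (subst sum.union_disjoint; (subst sum.union_disjoint)?) auto
  also have "(\<Sum>w\<in>nbrs G v \<inter> {u}. x w) = (if v \<in> nbrs G u then 1 else 0)"
    using nbrs_facts(4)[OF simple] u(2) by auto
  finally show ?thesis .
qed

lemma sum_common_nbrs_le:
  assumes "v \<noteq> u" "0 \<le> M" "\<And>w. w \<in> nbrs G u \<Longrightarrow> x w \<le> M"
  shows "(\<Sum>w\<in>nbrs G v \<inter> nbrs G u. x w) \<le> 2 * M"
proof -
  have "(\<Sum>w\<in>nbrs G v \<inter> nbrs G u. x w) \<le> of_nat (card (nbrs G v \<inter> nbrs G u)) * M"
    by (rule sum_bounded_above) (use assms in auto)
  also have "\<dots> \<le> 2 * M"
    using outerplanar_card_common_nbrs[OF simple outer assms(1)] assms(2) by (intro mult_right_mono) auto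
  finally show ?thesis .
qed

text \<open>Sum the eigenvalue equation over all vertices and bound the entries by 1; what remains
  is the degree sum.\<close>

lemma sum_le_4_card: "r * (\<Sum>v\<in>verts G. x v) \<le> 4 * real (card (verts G))"
proof -
  have "r * (\<Sum>v\<in>verts G. x v) = (\<Sum>v\<in>verts G. nbr_sum G x v)"
    by (simp add: sum_distrib_left eigen)
  also have "\<dots> \<le> (\<Sum>v\<in>verts G. real (card (nbrs G v \<inter> verts G)))"
  proof (rule sum_mono)
    fix v
    have "nbr_sum G x v \<le> of_nat (card (nbrs G v)) * 1"
      unfolding nbr_sum_def using nbrs_subset[OF simple, of v] le1 by (intro sum_bounded_above) auto
    also have "nbrs G v = nbrs G v \<inter> verts G" using nbrs_subset[OF simple, of v] by blast
    finally show "nbr_sum G x v \<le> real (card (nbrs G v \<inter> verts G))" by simp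
  qed
  also have "\<dots> = real (\<Sum>v\<in>verts G. card (nbrs G v \<inter> verts G))" by simp
  also have "\<dots> \<le> real (4 * card (verts G))"
    using outerplanar_degree_sum[OF simple outer fin(1)] by (intro of_nat_mono)
  finally show ?thesis by simp
qed

lemma card_W: "real (card W) = real (card (verts G)) - 1 - real (card (nbrs G u))"
proof -
  have "verts G = insert u (nbrs G u \<union> W)" using nbrs_subset[OF simple, of u] u(1) by (auto simp: W_def)
  moreover have "card (insert u (nbrs G u \<union> W)) = Suc (card (nbrs G u) + card W)"
    using u_notin_nbrs W_subset fin by (simp add: card_Un_disjoint Int_commute)
  ultimately have "card (verts G) = Suc (card (nbrs G u) + card W)" by simp
  then show ?thesis by simp
qed

text \<open>Counting walks of length two from \<open>u\<close>: \<open>r\<^sup>2 = r\<^sup>2 x\<^sub>u\<close> is the sum of \<open>x\<^sub>w\<close> weighted by the number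
  of common neighbours of \<open>u\<close> and \<open>w\<close>, which is at most two unless \<open>w = u\<close>.\<close>

lemma square_le_degree: "r\<^sup>2 \<le> real (card (nbrs G u)) + 2 * (\<Sum>v\<in>verts G. x v)"
proof -
  \<comment> \<open>\<open>c\<close> is the indicator of the neighbourhood of \<open>u\<close>, so
    \<open>nbr_sum G c v\<close> counts common neighbours, and symmetry of the operator exchanges
    the two summations.\<close>
  define c where "c v = (if v \<in> nbrs G u then 1 else 0 :: real)" for v
  have c: "nbr_sum G c v = real (card (nbrs G v \<inter> nbrs G u))" for v
    using fin(2)[of v] by (simp add: nbr_sum_def c_def sum.If_cases)
  have "r\<^sup>2 = r * nbr_sum G x u" using eigen[OF u(1)] u(2) by (simp add: power2_eq_square)
  also have "\<dots> = (\<Sum>v\<in>nbrs G u. nbr_sum G x v)"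
    using nbrs_subset[OF simple, of u] eigen unfolding nbr_sum_def[of G x u] sum_distrib_left
    by (intro sum.cong) auto
  also have "\<dots> = (\<Sum>v\<in>verts G. nbr_sum G x v * c v)"
    using nbrs_subset[OF simple, of u] fin(1) by (intro sum.mono_neutral_cong_left) (auto simp: c_def)
  also have "\<dots> = (\<Sum>v\<in>verts G. x v * nbr_sum G c v)" by (rule nbr_sum_symmetric[OF simple])
  also have "\<dots> = x u * nbr_sum G c u + (\<Sum>v\<in>verts G - {u}. x v * nbr_sum G c v)"
    using fin(1) u(1) by (rule sum.remove)
  also have "\<dots> \<le> real (card (nbrs G u)) + (\<Sum>v\<in>verts G - {u}. x v * 2)"
  proof (intro add_mono sum_mono)
    show "x u * nbr_sum G c u \<le> real (card (nbrs G u))" using u(2) by (simp add: c)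
    fix v assume v: "v \<in> verts G - {u}"
    then show "x v * nbr_sum G c v \<le> x v * 2"
      using outerplanar_card_common_nbrs[OF simple outer, of v u] pos[of v]
      unfolding c by (intro mult_left_mono) auto
  qed
  also have "(\<Sum>v\<in>verts G - {u}. x v * 2) \<le> (\<Sum>v\<in>verts G. x v * 2)"
    using fin(1) pos by (intro sum_mono2) (auto simp: less_imp_le)
  finally show ?thesis by (simp add: sum_distrib_left mult.commute)
qed

text \<open>As r^2 >= n - 1, the walk count leaves at most 2 (sum of x) vertices for
  \<open>W\<close>, and r times the sum of x is at most 4n. Thus \<open>W\<close> has order at most
  sqrt n.\<close>

lemma r_card_W: "r * real (card W) \<le> 8 * real (card (verts G))"
proof -
  have "real (card W) \<le> 2 * (\<Sum>v\<in>verts G. x v)" using card_W square_le_degree card_le by linarith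
  then have "r * real (card W) \<le> r * (2 * (\<Sum>v\<in>verts G. x v))" using r_large by (intro mult_left_mono) auto
  then show ?thesis using sum_le_4_card by simp
qed

text \<open>Sum the eigenvalue equation over \<open>W\<close>. No vertex of \<open>W\<close> sees
  \<open>u\<close>; each has at most two neighbours in the neighbourhood of \<open>u\<close>, and
  sparsity of the graph on \<open>W\<close> contributes 4 per vertex on average: 6 = 2 + 4.\<close>

lemma W_sum_le:
  assumes e: "0 \<le> e" "\<And>v. v \<in> verts G - {u} \<Longrightarrow> x v \<le> e"
  shows "r * (\<Sum>w\<in>W. x w) \<le> 6 * e * real (card W)"
proof -
  have "r * (\<Sum>w\<in>W. x w) = (\<Sum>w\<in>W. nbr_sum G x w)"
    unfolding sum_distrib_left using W_subset(1) by (intro sum.cong refl) (auto simp: eigen)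
  also have "\<dots> \<le> (\<Sum>w\<in>W. 2 * e + real (card (nbrs G w \<inter> W)) * e)"
  proof (rule sum_mono)
    fix w assume w: "w \<in> W"
    have "(\<Sum>v\<in>nbrs G w \<inter> nbrs G u. x v) \<le> 2 * e"
      by (rule sum_common_nbrs_le) (use w e W_subset nbrs_subset[OF simple, of u] u_notin_nbrs in auto)
    moreover have "(\<Sum>v\<in>nbrs G w \<inter> W. x v) \<le> of_nat (card (nbrs G w \<inter> W)) * e"
      by (rule sum_bounded_above) (use e W_subset in auto)
    moreover have "w \<notin> nbrs G u" using w W_subset by blast
    ultimately show "nbr_sum G x w \<le> 2 * e + real (card (nbrs G w \<inter> W)) * e"
      using nbr_sum_split[of w] by simp
  qed
  also have "\<dots> = 2 * e * real (card W) + real (\<Sum>w\<in>W. card (nbrs G w \<inter> W)) * e"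
    by (simp add: sum.distrib sum_distrib_right)
  also have "\<dots> \<le> 2 * e * real (card W) + real (4 * card W) * e"
    using outerplanar_degree_sum[OF simple outer fin(3)] e(1)
    by (intro add_left_mono mult_right_mono of_nat_mono)
  finally show ?thesis by (simp add: algebra_simps)
qed

text \<open>Two rounds: the bound \<open>x \<le> 1\<close> gives \<open>\<Sum>\<^sub>W x \<le> 6 |W| / r \<le> 48.006\<close>, hence \<open>r x\<^sub>v \<le> 3 + 48.006\<close> off \<open>u\<close>,
  and this sharper bound replaces \<open>1\<close> in the second round. The constant 3563 in the locale is
  \<open>\<lfloor>\<surd>(1.27 \<cdot> 10\<^sup>7 - 1)\<rfloor>\<close>.\<close>

lemma W_entries_small:
  assumes "w \<in> W"
  shows "r * x w < 1"
proof -
  define s where "s = (\<Sum>w\<in>W. x w)"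
  define q where "q = real (card W) / r"
  have r0: "0 < r" using r_large by simp
  have r2: "1000000 \<le> r\<^sup>2"
    using power_mono[of 1000 r 2] r_large by simp
  have "8 * real (card (verts G)) \<le> 8 * (r\<^sup>2 + 1)" using card_le by simp
  with r_card_W have "r * real (card W) \<le> 8 * (r\<^sup>2 + 1)" by (rule order_trans)
  \<comment> \<open>The excess 0.001 absorbs the \<open>+ 1\<close> from
    \<open>card_le\<close>.\<close>
  also have "\<dots> \<le> 8.001 * r\<^sup>2" using r2 by simp
  finally have "r * real (card W) \<le> 8.001 * r\<^sup>2" .
  moreover have "r * real (card W) = q * r\<^sup>2" using r0 by (simp add: q_def power2_eq_square)
  ultimately have "q * r\<^sup>2 \<le> 8.001 * r\<^sup>2" by simp
  then have q: "q \<le> 8.001" using r0 by (simp add: mult_le_cancel_right)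
  have q0: "0 \<le> q" using r0 by (simp add: q_def)
  have s_le: "s \<le> 6 * e * q" if "0 \<le> e" "\<And>v. v \<in> verts G - {u} \<Longrightarrow> x v \<le> e" for e
    using W_sum_le[OF that] r0 by (simp add: s_def q_def field_simps)
  have s1: "s \<le> 48.006" using s_le[of 1] le1 q by auto
  define e where "e = 51.006 / r"
  have e0: "0 \<le> e" using r0 by (simp add: e_def)
  have W_part: "(\<Sum>w\<in>nbrs G v \<inter> W. x w) \<le> s" for v
    unfolding s_def using fin(3) W_subset pos by (intro sum_mono2) (auto simp: less_imp_le subset_iff)
  have e: "x v \<le> e" if v: "v \<in> verts G - {u}" for v
  proof -
    have "(\<Sum>w\<in>nbrs G v \<inter> nbrs G u. x w) \<le> 2 * 1"
      by (rule sum_common_nbrs_le) (use v le1 nbrs_subset[OF simple, of u] in auto)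
    then have "nbr_sum G x v \<le> 2 + s + 1" using nbr_sum_split[of v] W_part[of v] by auto
    then have "r * x v \<le> 51.006" using eigen[of v] v s1 by auto
    then show ?thesis using r0 by (simp add: e_def field_simps)
  qed
  \<comment> \<open>51.006 / 3563 is about 0.01432. The second round then gives \<open>s\<close> at
    most 0.7, and \<open>2 * e + s\<close> stays below 1.\<close>
  have e1: "e \<le> 0.0144" using r_large r0 by (simp add: e_def field_simps)
  have "s \<le> 6 * e * q" by (rule s_le[OF e0 e])
  also have "\<dots> \<le> 6 * 0.0144 * 8.001" using e0 e1 q q0 by (intro mult_mono) auto
  finally have s2: "s \<le> 0.7" by simp
  have "(\<Sum>v\<in>nbrs G w \<inter> nbrs G u. x v) \<le> 2 * e"
    by (rule sum_common_nbrs_le) (use assms e e0 W_subset nbrs_subset[OF simple, of u] u_notin_nbrs in auto)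
  moreover have "w \<notin> nbrs G u" using assms W_subset by blast
  ultimately have "nbr_sum G x w \<le> 2 * e + s" using nbr_sum_split[of w] W_part[of w] by simp
  then show ?thesis using eigen[of w] assms W_subset e1 s2 by auto
qed

text \<open>Deleting the edges at \<open>W\<close> costs at most \<open>r \<Sum>\<^sub>w x\<^sub>w\<^sup>2\<close>, joining \<open>W\<close> to \<open>u\<close> gains \<open>\<Sum>\<^sub>w x\<^sub>w\<close>
  (both counted twice in the quadratic form).\<close>

lemma star_shift_gain:
  assumes "W \<noteq> {}"
  defines "b \<equiv> \<lambda>v w. if v \<noteq> w \<and> (v = u \<or> w = u \<or> v \<in> nbrs G u \<and> w \<in> nbrs G u \<and> w \<in> nbrs G v) then 1 else 0 :: real"
  shows "r * (\<Sum>v\<in>verts G. (x v)\<^sup>2) < (\<Sum>v\<in>verts G. \<Sum>w\<in>verts G. b v w * (x v * x w))"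
proof -
  define D where "D f = (\<Sum>v\<in>verts G. \<Sum>w\<in>verts G. f v w * (x v * x w))" for f :: "'a \<Rightarrow> 'a \<Rightarrow> real"
  define a where "a v w = (if w \<in> nbrs G v then 1 else 0 :: real)" for v w
  \<comment> \<open>\<open>a\<close> and \<open>b\<close> are the adjacencies before and after the
    shift. \<open>g\<close> and \<open>l\<close> record gained and lost pairs in one orientation
    only, hence the factor 2 on their sums.\<close>
  define g where "g v w = (if v = u \<and> w \<in> W then 1 else 0 :: real)" for v w
  define l where "l v w = (if v \<in> W then a v w else 0)" for v w
  have D_add: "D (\<lambda>v w. f v w + h v w) = D f + D h" for f h
    by (simp add: D_def distrib_right sum.distrib)
  have D_swap: "D (\<lambda>v w. f w v) = D f" for f
    unfolding D_def by (subst sum.swap) (simp add: mult.commute)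
  have a_sum: "(\<Sum>w\<in>verts G. a v w * (x v * x w)) = x v * nbr_sum G x v" for v
    unfolding nbr_sum_if[OF simple] a_def sum_distrib_left by (intro sum.cong) auto
  have Da: "D a = r * (\<Sum>v\<in>verts G. (x v)\<^sup>2)"
    unfolding D_def a_sum sum_distrib_left by (intro sum.cong) (auto simp: eigen power2_eq_square)
  have Dg: "D g = (\<Sum>w\<in>W. x w)"
  proof -
    have "D g = (\<Sum>v\<in>verts G. if v = u then (\<Sum>w\<in>verts G. if w \<in> W then x w else 0) else 0)"
      unfolding D_def g_def by (intro sum.cong refl) (auto simp: u(2) intro!: sum.cong sum.neutral)
    also have "\<dots> = (\<Sum>w\<in>verts G. if w \<in> W then x w else 0)" using fin(1) u(1) by simp
    also have "\<dots> = (\<Sum>w\<in>W. x w)"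
      using fin(1) W_subset(1) by (simp add: sum.inter_restrict[symmetric] Int_absorb1)
    finally show ?thesis .
  qed
  have Dl: "D l = (\<Sum>w\<in>W. x w * (r * x w))"
  proof -
    have "D l = (\<Sum>v\<in>verts G. if v \<in> W then x v * nbr_sum G x v else 0)"
      unfolding D_def l_def a_sum[symmetric] by (intro sum.cong refl) auto
    also have "\<dots> = (\<Sum>v\<in>W. x v * nbr_sum G x v)"
      using fin(1) W_subset(1) by (simp add: sum.inter_restrict[symmetric] Int_absorb1)
    also have "\<dots> = (\<Sum>w\<in>W. x w * (r * x w))"
      using W_subset(1) by (intro sum.cong) (auto simp: eigen)
    finally show ?thesis .
  qed
  \<comment> \<open>Equality holds except for edges inside \<open>W\<close>, which \<open>l\<close>
    counts from both ends.\<close>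
  have pt: "a v w + g v w + g w v \<le> b v w + l v w + l w v" if "v \<in> verts G" "w \<in> verts G" for v w
  proof -
    have sym: "w \<in> nbrs G v \<longleftrightarrow> v \<in> nbrs G w" "v \<in> nbrs G v \<longleftrightarrow> False" "w \<in> nbrs G w \<longleftrightarrow> False" for v w
      using nbrs_facts(1,4)[OF simple] by blast+
    have "v = u \<or> v \<in> nbrs G u \<or> v \<in> W" "w = u \<or> w \<in> nbrs G u \<or> w \<in> W"
      using that by (auto simp: W_def)
    then show ?thesis
      using W_subset(2) u_notin_nbrs disjoint_iff[THEN iffD1, OF W_subset(3)] sym(1)[of u v] sym(1)[of u w]
        sym(1)[of v w] sym(2)[of v] sym(2)[of w]
      unfolding a_def g_def l_def b_def by (elim disjE) auto
  qed
  have "D (\<lambda>v w. a v w + g v w + g w v) \<le> D (\<lambda>v w. b v w + l v w + l w v)"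
    unfolding D_def using pt pos by (intro sum_mono mult_right_mono) (auto simp: less_imp_le)
  then have "D a + 2 * D g \<le> D b + 2 * D l"
    unfolding D_add D_swap[of g] D_swap[of l] by simp
  moreover have "D l < D g"
    unfolding Dl Dg
  proof (rule sum_strict_mono)
    fix w assume w: "w \<in> W"
    then show "x w * (r * x w) < x w" using W_entries_small[OF w] pos[of w] W_subset(1) by auto
  qed (use assms fin in auto)
  ultimately show ?thesis using Da unfolding D_def by linarith
qed

text \<open>Position \<open>i\<close> in \<open>L\<close> becomes vertex \<open>i\<close> of the
  fan: hub, neighbours in path order, then \<open>W\<close> as bare leaves. Since x is positive, it
  suffices that every pair counted by the shifted form is adjacent in the fan.\<close>

lemma fan_spectral_radius_greater:
  assumes W: "W \<noteq> {}" and L: "distinct L" "L = u # vs @ ws" "set vs = nbrs G u" "set ws = W"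
    and E: "{e \<in> edges G. e \<subseteq> nbrs G u} \<subseteq> path_edges vs"
    and I: "I = {i. 0 < i \<and> i < length vs \<and> {L ! i, L ! Suc i} \<in> edges G}"
  shows "r < graph_spectral_radius (fan (card (verts G)) I)"
proof -
  let ?n = "card (verts G)" and ?H = "fan (card (verts G)) I"
  have setL: "set L = verts G" using L(2-4) u(1) nbrs_subset[OF simple, of u] by (auto simp: W_def)
  then have len: "length L = ?n" using distinct_card[OF L(1)] by simp
  have bij: "bij_betw ((!) L) {..<?n} (verts G)"
    by (rule bij_betw_nth[OF L(1)]) (simp_all add: len setL)
  define y where "y i = x (L ! i)" for i
  define b where "b v w = (if v \<noteq> w \<and> (v = u \<or> w = u \<or> v \<in> nbrs G u \<and> w \<in> nbrs G u \<and> w \<in> nbrs G v) then 1 else 0 :: real)" for v w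
  have L0: "L ! 0 = u" using L(2) by simp
  have adj: "j \<in> nbrs ?H i" if ij: "i < ?n" "j < ?n" "b (L ! i) (L ! j) \<noteq> 0" for i j
  proof -
    have ne: "L ! i \<noteq> L ! j" and b: "L ! i = u \<or> L ! j = u \<or> L ! i \<in> nbrs G u \<and> L ! j \<in> nbrs G u \<and> L ! j \<in> nbrs G (L ! i)"
      using ij(3) unfolding b_def by (auto split: if_splits)
    then have "i \<noteq> j" by auto
    have zero: "k = 0" if "L ! k = u" "k < ?n" for k
      using that L0 L(1) len nth_eq_iff_index_eq[of L k 0] by auto
    consider "i = 0" | "j = 0" | "L ! i \<in> nbrs G u \<and> L ! j \<in> nbrs G u \<and> L ! j \<in> nbrs G (L ! i)"
      using b zero ij by blast
    then show ?thesis
    proof cases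
      case 1 then show ?thesis using ij \<open>i \<noteq> j\<close> by (auto simp: nbrs_def fan_def)
    next
      case 2 then show ?thesis using ij \<open>i \<noteq> j\<close> by (auto simp: nbrs_def fan_def insert_commute)
    next
      case 3
      then have "{L ! i, L ! j} \<in> edges G" by (simp add: nbrs_def)
      then have "{L ! i, L ! j} \<in> path_edges vs" using E 3 by auto
      then obtain k where k: "Suc k < length vs" "{L ! i, L ! j} = {vs ! k, vs ! Suc k}"
        by (auto simp: path_edges_nth)
      \<comment> \<open>The hub at the head of \<open>L\<close> shifts all positions of
        \<open>vs\<close> by one.\<close>
      have kL: "L ! Suc k = vs ! k" "L ! Suc (Suc k) = vs ! Suc k" "Suc (Suc k) < ?n"
        using k(1) L(2) len by (auto simp: nth_append)
      then have "L ! i = L ! Suc k \<and> L ! j = L ! Suc (Suc k) \<or> L ! i = L ! Suc (Suc k) \<and> L ! j = L ! Suc k"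
        using k(2) by (auto simp: doubleton_eq_iff)
      then have "{i, j} = {Suc k, Suc (Suc k)}"
        using kL(3) ij len L(1) by (auto simp: nth_eq_iff_index_eq)
      moreover have "Suc k \<in> I" using k \<open>{L ! i, L ! j} \<in> edges G\<close> kL by (auto simp: I)
      ultimately show ?thesis using kL(3) by (auto simp: nbrs_def fan_def)
    qed
  qed
  have sq: "(\<Sum>i<?n. (y i)\<^sup>2) = (\<Sum>v\<in>verts G. (x v)\<^sup>2)"
    unfolding y_def by (rule sum.reindex_bij_betw[OF bij])
  have y0: "0 \<le> y i" if "i < ?n" for i
    using pos[of "L ! i"] that len setL nth_mem[of i L] by (simp add: y_def)
  have "r * (\<Sum>v\<in>verts G. (x v)\<^sup>2) < (\<Sum>v\<in>verts G. \<Sum>w\<in>verts G. b v w * (x v * x w))"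
    using star_shift_gain[OF W] unfolding b_def .
  also have "\<dots> = (\<Sum>i<?n. \<Sum>j<?n. b (L ! i) (L ! j) * (y i * y j))"
    unfolding y_def sum.reindex_bij_betw[OF bij, symmetric] ..
  also have "\<dots> \<le> (\<Sum>i<?n. \<Sum>j<?n. y i * (if j \<in> nbrs ?H i then y j else 0))"
  proof (intro sum_mono)
    fix i j assume ij: "i \<in> {..<?n}" "j \<in> {..<?n}"
    show "b (L ! i) (L ! j) * (y i * y j) \<le> y i * (if j \<in> nbrs ?H i then y j else 0)"
    proof (cases "b (L ! i) (L ! j) = 0")
      case True then show ?thesis using y0 ij by auto
    next
      case False
      moreover from this have "b (L ! i) (L ! j) = 1" by (auto simp: b_def split: if_splits)
      ultimately show ?thesis using adj[of i j] ij by simp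
    qed
  qed
  also have "\<dots> = (\<Sum>i<?n. y i * nbr_sum ?H y i)"
    unfolding nbr_sum_if[OF simple_graph_fan] by (simp add: sum_distrib_left)
  also have "\<dots> \<le> graph_spectral_radius ?H * (\<Sum>v\<in>verts G. (x v)\<^sup>2)"
    using rayleigh_le_graph_spectral_radius[OF simple_graph_fan, of y ?n I] by (simp add: sq)
  finally have "r * (\<Sum>v\<in>verts G. (x v)\<^sup>2) < graph_spectral_radius ?H * (\<Sum>v\<in>verts G. (x v)\<^sup>2)" .
  moreover have "0 < (\<Sum>v\<in>verts G. (x v)\<^sup>2)"
    by (intro sum_pos zero_less_power pos) (use fin(1) u(1) in auto)
  ultimately show ?thesis by simp
qed

text \<open>Once the copy of \<open>F\<close> has been moved off the leaves from \<open>W\<close>,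
  it uses only \<open>u\<close>, neighbours of \<open>u\<close> and rim edges that were already
  edges of \<open>G\<close>.\<close>

lemma fan_contained_in_G:
  assumes F: "simple_graph F" "card (verts F) \<le> length vs" "contained_in F (fan n I)"
    and L: "distinct L" "L = u # vs @ ws" "set vs = nbrs G u" "set L \<subseteq> verts G"
    and I: "I = {i. 0 < i \<and> i < length vs \<and> {L ! i, L ! Suc i} \<in> edges G}"
  shows "contained_in F G"
proof -
  let ?d = "length vs"
  have "contained_in F (fan (Suc ?d) I)"
    by (rule fan_contained_in_smaller_fan[OF F(1,3,2)]) (auto simp: I)
  then show ?thesis
  proof (rule contained_in_embed[OF F(1), where h = "(!) L"])
    show "inj_on ((!) L) (verts (fan (Suc ?d) I))"
      using L(1,2) by (intro inj_on_nth) auto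
    show "(!) L ` verts (fan (Suc ?d) I) \<subseteq> verts G"
    proof
      fix z assume "z \<in> (!) L ` verts (fan (Suc ?d) I)"
      then obtain i where i: "i < Suc ?d" "z = L ! i" by auto
      then have "i < length L" using L(2) by simp
      then show "z \<in> verts G" using i(2) L(4) nth_mem[of i L] by auto
    qed
    show "(!) L ` e \<in> edges G" if "e \<in> edges (fan (Suc ?d) I)" for e
      using that
    proof (cases rule: fan_edge_cases)
      case (spoke i)
      then obtain k where k: "i = Suc k" "k < ?d" using gr0_implies_Suc by auto
      then have "L ! i = vs ! k" by (simp add: L(2) nth_append)
      then have "{u, L ! i} \<in> edges G" using L(3) nth_mem[OF k(2)] by (simp add: nbrs_def)
      then show ?thesis using spoke by (simp add: L(2))
    next
      case (rim i) then show ?thesis by (simp add: I)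
    qed
  qed
qed

end

section \<open>Consequences of a dominating vertex, and the final assembly\<close>

lemma contained_in_complete_bipartite_star:
  assumes "simple_graph G" "u \<in> verts G" "nbrs G u = verts G - {u}" "card (verts G) = n"
  shows "contained_in (complete_bipartite 1 (n - 1)) G"
proof -
  have fin: "finite (verts G)" using assms(1) by (simp add: simple_graph_def)
  have "card {..<n - 1} = card (nbrs G u)" using assms fin by simp
  then obtain h where h: "bij_betw h {..<n - 1} (nbrs G u)"
    using finite_same_card_bij[of "{..<n - 1}" "nbrs G u"] fin assms(3) by auto
  define g where "g = case_sum (\<lambda>_ :: nat. u) h"
  have hu: "h i \<in> nbrs G u" if "i < n - 1" for i using bij_betwE[OF h] that by auto
  have "simple_graph (complete_bipartite 1 (n - 1))"
    by (auto simp: simple_graph_def complete_bipartite_def)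
  then show ?thesis
  proof (rule contained_inI[where g = g])
    show "inj_on g (verts (complete_bipartite 1 (n - 1)))"
    proof -
      have "u \<notin> h ` {..<n - 1}" using hu assms(3) by auto
      with bij_betw_imp_inj_on[OF h] show ?thesis
        by (auto simp: complete_bipartite_def inj_on_def g_def)
    qed
    show "g ` verts (complete_bipartite 1 (n - 1)) \<subseteq> verts G"
      using hu assms by (auto simp: complete_bipartite_def g_def)
    show "g ` e \<in> edges G" if "e \<in> edges (complete_bipartite 1 (n - 1))" for e
      using that hu by (auto simp: complete_bipartite_def g_def nbrs_def)
  qed
qed

lemma outerplanar_nbhd_union_of_paths:
  assumes "simple_graph G" "outerplanar G"
  shows "union_of_paths (induced G (nbrs G u))"
proof -
  obtain vs where "distinct vs" "set vs = nbrs G u" "{e \<in> edges G. e \<subseteq> nbrs G u} \<subseteq> path_edges vs"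
    using outerplanar_nbhd_linear[OF assms subset_refl] by blast
  then show ?thesis
    using nbrs_subset[OF assms(1), of u] by (intro union_of_pathsI[of vs]) (auto simp: induced_def)
qed

theorem theorem1:
  fixes n t :: nat and F :: "'b ugraph" and G :: "'a ugraph" and x :: "'a \<Rightarrow> real"
  assumes "1 \<le> t" and "real t \<le> (real n - 1) / 2"
    and "simple_graph F" and "outerplanar F"
    and "contained_in F (join_graph (complete_graph 1) (path_graph (n - 1)))"
    and "\<not> contained_in F (join_graph (complete_graph 1)
           (disj_union (copies (t - 1) (complete_graph 2))
                       (copies (n - 2 * t + 1) (complete_graph 1))))"
    and "real n \<ge> max (1.27 * 10 ^ 7) ((sqrt (64 + real (card (verts F))) + 8) ^ 2)"
    and "simple_graph G" and "card (verts G) = n" and "connected_graph G"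
    and "outerplanar G" and "\<not> contained_in F G"
    and "graph_spectral_radius G = spex_OP n F"
    and "eigenvector (adj_matrix G) (vertex_vector G x) (graph_spectral_radius G)"
    and "\<forall>v\<in>verts G. x v > 0" and "Max (x ` verts G) = 1"
  shows "\<exists>u\<in>verts G. nbrs G u = verts G - {u} \<and> x u = 1 \<and>
           contained_in (complete_bipartite 1 (n - 1)) G \<and>
           union_of_paths (induced G (nbrs G u))"
proof -
  define r where "r = graph_spectral_radius G"
  define f where "f = real (card (verts F))"
  have n: "12700000 \<le> real n" "(sqrt (64 + f) + 8)\<^sup>2 \<le> real n"
    using assms(7) by (auto simp: f_def)
  have finV: "finite (verts G)" using assms(8) by (simp add: simple_graph_def)
  have "verts G \<noteq> {}" using n assms(9) by auto
  then obtain u where u: "u \<in> verts G" "x u = 1"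
    using Max_in[of "x ` verts G"] finV assms(16) by auto
  have star: "sqrt (real n - 1) \<le> r"
  proof -
    \<comment> \<open>This keeps the natural-number subtraction honest: the excluded graph has 2(t -
      1) + (n - 2t + 1) = n - 1 vertices besides its hub.\<close>
    have "real (2 * t + 1) \<le> real n" using assms(2) by simp
    then have "2 * t + 1 \<le> n" by (simp only: of_nat_le_iff)
    then have t: "2 * t \<le> n - 1" by simp
    have "\<not> contained_in F (fan n {})"
    proof
      assume "contained_in F (fan n {})"
      then have "contained_in F (join_graph (complete_graph 1)
           (disj_union (copies (t - 1) (complete_graph 2)) (copies (n - 2 * t + 1) (complete_graph 1))))"
      proof (rule star_contained_in_join[OF assms(3)])
        show "finite (verts (disj_union (copies (t - 1) (complete_graph 2)) (copies (n - 2 * t + 1) (complete_graph 1))))"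
          by (simp add: disj_union_def card_verts_copies_complete)
        show "card (verts (disj_union (copies (t - 1) (complete_graph 2)) (copies (n - 2 * t + 1) (complete_graph 1)))) = n - 1"
          using t assms(1) by (simp add: disj_union_def card_Plus card_verts_copies_complete)
      qed
      then show False using assms(6) by blast
    qed
    then have "graph_spectral_radius (fan n {}) \<le> r"
      unfolding r_def assms(13) by (intro graph_spectral_radius_le_spex_OP simple_graph_fan outerplanar_fan) auto
    moreover have "2 \<le> n" using n(1) by linarith
    ultimately show ?thesis using star_spectral_radius[of n] by linarith
  qed
  have "sqrt (3563\<^sup>2) \<le> sqrt (real n - 1)" using n(1) by (intro real_sqrt_le_mono) simp
  then have r: "3563 \<le> r" using star by simp
  have "(sqrt (real n - 1))\<^sup>2 \<le> r\<^sup>2" using star n(1) by (intro power_mono) auto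
  then have r2: "real n \<le> r\<^sup>2 + 1" using n(1) by simp
  interpret outerplanar_eigenvector G x r u
  proof
    show "nbr_sum G x v = r * x v" if "v \<in> verts G" for v
      using eigenvector_nbr_sum[OF assms(8,14) that] by (simp add: r_def)
    show "x v \<le> 1" if "v \<in> verts G" for v
      using Max_ge[of "x ` verts G" "x v"] finV that assms(16) by simp
  qed (use assms u r r2 in auto)
  have "W = {}"
  proof (rule ccontr)
    assume W: "W \<noteq> {}"
    obtain vs where vs: "distinct vs" "set vs = nbrs G u" "{e \<in> edges G. e \<subseteq> nbrs G u} \<subseteq> path_edges vs"
      using outerplanar_nbhd_linear[OF simple outer subset_refl] by blast
    obtain ws where ws: "set ws = W" "distinct ws" using finite_distinct_list[OF fin(3)] by blast
    define L where "L = u # vs @ ws"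
    have L: "distinct L" "set L \<subseteq> verts G"
      using vs ws W_subset u_notin_nbrs u(1) nbrs_subset[OF simple, of u] by (auto simp: L_def)
    define I where "I = {i. 0 < i \<and> i < length vs \<and> {L ! i, L ! Suc i} \<in> edges G}"
    have "r < graph_spectral_radius (fan n I)"
      using fan_spectral_radius_greater[OF W L(1) L_def vs(2) ws(1) vs(3) I_def] assms(9) by simp
    moreover have "card (verts F) \<le> length vs"
    proof -
      \<comment> \<open>In terms of \<open>s\<close>, the condition on n solves to f <= s^2 - 16 s,
        while \<open>W\<close> has at most 12 s vertices. So \<open>u\<close> has at least s^2 - 1 -
        12 s neighbours, and the gap of 4 s covers the 1.\<close>
      define s where "s = sqrt (real n)"
      have s: "3000 \<le> s" "s\<^sup>2 = real n" using real_sqrt_le_mono[of "3000\<^sup>2" "real n"] n(1) by (auto simp: s_def)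
      have "sqrt (64 + f) + 8 \<le> s"
        unfolding s_def using n(2) by (intro real_le_rsqrt)
      then have "(sqrt (64 + f))\<^sup>2 \<le> (s - 8)\<^sup>2" by (intro power_mono) (auto simp: f_def)
      then have f: "f \<le> s\<^sup>2 - 16 * s" by (simp add: f_def power2_diff)
      \<comment> \<open>A crude comparison of r with sqrt n suffices: the factor 3/2 turns the 8 of
        \<open>r_card_W\<close> into 12, still below 16.\<close>
      have "s * 2 \<le> r * 3"
      proof -
        have "s\<^sup>2 * 4 \<le> r\<^sup>2 * 9" using s(2) r2 n(1) by simp
        then have "(s * 2)\<^sup>2 \<le> (r * 3)\<^sup>2" by (simp add: power_mult_distrib)
        then show ?thesis by (rule power2_le_imp_le) (use r in simp)
      qed
      then have "s * 2 * real (card W) \<le> r * 3 * real (card W)" by (intro mult_right_mono) auto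
      also have "\<dots> \<le> 24 * s\<^sup>2" using r_card_W assms(9) s(2) by simp
      finally have "s * real (card W) \<le> s * (12 * s)" by (simp add: power2_eq_square)
      then have "real (card W) \<le> 12 * s" using s(1) by simp
      then have "f \<le> real (card (nbrs G u))" using f card_W assms(9) s by simp
      then show ?thesis using distinct_card[OF vs(1)] vs(2) by (simp add: f_def)
    qed
    then have "\<not> contained_in F (fan n I)"
      using fan_contained_in_G[OF assms(3) _ _ L(1) L_def vs(2) L(2) I_def] assms(12) by blast
    then have "graph_spectral_radius (fan n I) \<le> r"
      unfolding r_def assms(13) by (intro graph_spectral_radius_le_spex_OP simple_graph_fan outerplanar_fan) auto
    ultimately show False by simp
  qed
  then have "nbrs G u = verts G - {u}"
    using nbrs_subset[OF simple, of u] u_notin_nbrs by (auto simp: W_def)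
  then show ?thesis
    using u contained_in_complete_bipartite_star[OF simple u(1) _ assms(9)]
      outerplanar_nbhd_union_of_paths[OF simple outer] by blast
qed

end
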